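(* Let $H$ be a complex Hilbert space with $\dim H>1$. Let $\phi:B_s(H)\to B_s(H)$ be a bijective map which preserves the order and the orthogonality in both directions, i.e. for all $A,B\in B_s(H)$, \[ A\leq B \Longleftrightarrow \phi(A)\leq\phi(B) \qquad\text{and}\qquad AB=0 \Longleftrightarrow \phi(A)\phi(B)=0. \] Then there are an either unitary or antiunitary operator $U:H\to H$ and a positive scalar $\lambda$ such that \[ \phi(A)=\lambda UAU^* \qquad \text{for all } A\in B_s(H). \]
   Context: $H$ is a complex Hilbert space (of arbitrary, possibly infinite, dimension). $B_s(H)$ denotes the set of all self-adjoint bounded linear operators on $H$. For $A,B\in B_s(H)$, $A\leq B$ means $\langle Ax,x\rangle\leq\langle Bx,x\rangle$ for every $x\in H$. Two operators $A,B\in B_s(H)$ are called orthogonal if $AB=0$. No linearity or continuity of $\phi$ is assumed. An antiunitary operator is a bijective conjugate-linear isometry $U:H\to H$; for such $U$, the adjoint $U^*$ is the conjugate-linear operator determined by $\langle Ux,y\rangle=\langle U^*y,x\rangle$ for all $x,y\in H$, which equals $U^{-1}$. *)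

theory Defs
  imports "HOL-Analysis.Analysis" "HOL-Library.Extended_Nat"
begin

text \<open>
  Complex inner product spaces. The inner product is linear in its first argument.
  The class extends \<open>real_inner\<close>, whose real structure is required to be the one induced by
  the complex structure; in particular the norm is \<open>sqrt (Re (cinner x x))\<close>.
\<close>

class complex_inner = real_inner +
  fixes scaleC :: "complex \<Rightarrow> 'a \<Rightarrow> 'a" (infixr \<open>*\<^sub>C\<close> 75)
    and cinner :: "'a \<Rightarrow> 'a \<Rightarrow> complex"
  assumes scaleC_add_right: "c *\<^sub>C (x + y) = c *\<^sub>C x + c *\<^sub>C y"
    and scaleC_add_left: "(c + d) *\<^sub>C x = c *\<^sub>C x + d *\<^sub>C x"
    and scaleC_scaleC: "c *\<^sub>C d *\<^sub>C x = (c * d) *\<^sub>C x"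
    and scaleR_eq_scaleC: "r *\<^sub>R x = complex_of_real r *\<^sub>C x"
    and cinner_commute: "cinner x y = cnj (cinner y x)"
    and cinner_add_left: "cinner (x + y) z = cinner x z + cinner y z"
    and cinner_scaleC_left: "cinner (c *\<^sub>C x) y = c * cinner x y"
    and inner_eq_Re_cinner: "x \<bullet> y = Re (cinner x y)"

class complex_hilbert_space = complex_inner + complete_space

global_interpretation complex_vector:
  vector_space "scaleC :: complex \<Rightarrow> 'a \<Rightarrow> 'a::complex_inner"
proof
  fix x :: 'a
  show "1 *\<^sub>C x = x"
    using scaleR_eq_scaleC[of 1 x] by simp
qed (simp_all add: scaleC_add_right scaleC_add_left scaleC_scaleC)

text \<open>
  The library's \<open>dim\<close> returns 0 on infinite-dimensional spaces, hence the case distinction.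
\<close>

definition cdim :: "'a::complex_inner itself \<Rightarrow> enat" where
  "cdim _ = (if \<exists>B::'a set. finite B \<and> complex_vector.span B = UNIV
             then enat (complex_vector.dim (UNIV :: 'a set)) else \<infinity>)"

definition bounded_clinear :: "('a::complex_inner \<Rightarrow> 'a) \<Rightarrow> bool" where
  "bounded_clinear A \<longleftrightarrow> bounded_linear A \<and> (\<forall>c x. A (c *\<^sub>C x) = c *\<^sub>C A x)"

definition is_cadjoint :: "('a::complex_inner \<Rightarrow> 'a) \<Rightarrow> ('a \<Rightarrow> 'a) \<Rightarrow> bool" where
  "is_cadjoint A B \<longleftrightarrow> (\<forall>x y. cinner (A x) y = cinner x (B y))"

definition cadjoint :: "('a::complex_inner \<Rightarrow> 'a) \<Rightarrow> 'a \<Rightarrow> 'a" where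
  "cadjoint A = (THE B. is_cadjoint A B)"

text \<open>The adjoint of a bounded conjugate-linear operator.\<close>

definition is_conj_adjoint :: "('a::complex_inner \<Rightarrow> 'a) \<Rightarrow> ('a \<Rightarrow> 'a) \<Rightarrow> bool" where
  "is_conj_adjoint A B \<longleftrightarrow> (\<forall>x y. cinner (A x) y = cinner (B y) x)"

definition conj_adjoint :: "('a::complex_inner \<Rightarrow> 'a) \<Rightarrow> 'a \<Rightarrow> 'a" where
  "conj_adjoint A = (THE B. is_conj_adjoint A B)"

definition selfadjoint_ops :: "('a::complex_inner \<Rightarrow> 'a) set" where
  "selfadjoint_ops = {A. bounded_clinear A \<and> is_cadjoint A A}"

text \<open>
  Used for self-adjoint operators only, where \<open>cinner (A x) x\<close> is real.
\<close>

definition op_le :: "('a::complex_inner \<Rightarrow> 'a) \<Rightarrow> ('a \<Rightarrow> 'a) \<Rightarrow> bool" where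
  "op_le A B \<longleftrightarrow> (\<forall>x. Re (cinner (A x) x) \<le> Re (cinner (B x) x))"

definition op_orthogonal :: "('a::complex_inner \<Rightarrow> 'a) \<Rightarrow> ('a \<Rightarrow> 'a) \<Rightarrow> bool" where
  "op_orthogonal A B \<longleftrightarrow> A \<circ> B = (\<lambda>x. 0)"

definition unitary_op :: "('a::complex_inner \<Rightarrow> 'a) \<Rightarrow> bool" where
  "unitary_op U \<longleftrightarrow> bounded_clinear U \<and> cadjoint U \<circ> U = id \<and> U \<circ> cadjoint U = id"

definition antiunitary_op :: "('a::complex_inner \<Rightarrow> 'a) \<Rightarrow> bool" where
  "antiunitary_op U \<longleftrightarrow> bij U \<and> (\<forall>x y. U (x + y) = U x + U y) \<and>
     (\<forall>c x. U (c *\<^sub>C x) = cnj c *\<^sub>C U x) \<and> (\<forall>x. norm (U x) = norm x)"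

text \<open>The two adjoints are uniquely determined whenever they exist.\<close>

lemma cinner_eq_zeroD:
  assumes "\<And>x. cinner x y = 0"
  shows "y = (0::'a::complex_inner)"
  using assms[of y] inner_eq_Re_cinner[of y y] by simp

lemma cinner_diff_left: "cinner (x - y) z = cinner x z - cinner (y::'a::complex_inner) z"
  using cinner_add_left[of "x - y" y z] by simp

lemma cinner_right_cancel:
  assumes "\<And>x. cinner x y = cinner x z"
  shows "y = (z::'a::complex_inner)"
proof -
  have "cinner x (y - z) = 0" for x
    using assms[of x]
    by (metis cinner_commute cinner_diff_left complex_cnj_zero right_minus_eq)
  then show ?thesis
    using cinner_eq_zeroD[of "y - z"] by simp
qed

lemma cadjoint_eqI:
  assumes "is_cadjoint A B"
  shows "cadjoint A = B"
  unfolding cadjoint_def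
proof (rule the_equality, rule assms)
  fix C assume "is_cadjoint A C"
  with assms have "cinner x (C y) = cinner x (B y)" for x y
    by (simp add: is_cadjoint_def)
  then show "C = B"
    by (intro ext cinner_right_cancel)
qed

lemma conj_adjoint_eqI:
  assumes "is_conj_adjoint A B"
  shows "conj_adjoint A = B"
  unfolding conj_adjoint_def
proof (rule the_equality, rule assms)
  fix C assume "is_conj_adjoint A C"
  with assms have "cinner x (C y) = cinner x (B y)" for x y
    using cinner_commute[of x "C y"] cinner_commute[of x "B y"]
    by (metis is_conj_adjoint_def)
  then show "C = B"
    by (intro ext cinner_right_cancel)
qed

end

theory Submission
  imports Defs
begin

text \<open>
  Write \<open>outer x\<close> for the operator \<open>|x><x|\<close> of rank one. The order alone determines which
  differences of operators have this form: for \<open>A \<le> B\<close>, the interval \<open>[A, B]\<close> is a chain iff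
  \<open>B - A = outer x\<close> for some \<open>x\<close> (\<open>chain_iff_rank_one\<close>). Therefore an order automorphism \<open>f\<close> maps
  each line \<open>A + t outer x\<close> onto a line \<open>f A + s outer y\<close>. For \<open>A \<le> B\<close>, the images of the lines
  through \<open>A\<close> and \<open>B\<close> along \<open>outer x\<close> are comparable for all \<open>t\<close>, which is possible only if
  they are parallel; as any two operators have a common upper bound, \<open>y\<close> depends on \<open>x\<close> only
  (\<open>image_direction\<close>).

  Let \<open>s\<close> be the parameter on the image line as a function of \<open>t\<close>. Moving along
  two sides of a parallelogram in either order shows that this function does not change when \<open>A\<close>
  moves in a direction \<open>outer y\<close> with \<open>y\<close> independent of \<open>x\<close>. By the parallelogram law such
  moves generate the moves along \<open>outer x\<close>, provided that the dimension exceeds one. So the function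
  is additive and increasing, hence linear, and the comparison of parallel lines shows that its
  slope is the same for all \<open>A\<close>. In other words, there is a map \<open>V\<close> of vectors with
  \<open>f (A + t outer x) = f A + t outer (V x)\<close> (\<open>rank_one_affine\<close>).

  Orthogonality now enters. It yields \<open>f 0 = 0\<close>, so real linear relations between operators
  \<open>outer x\<close> carry over to the operators \<open>outer (V x)\<close>, and it makes \<open>V\<close> preserve
  orthogonality of vectors. For a fixed vector \<open>e\<close>, the operators \<open>|e><x| + |x><e|\<close> are such
  combinations and real linear in \<open>x\<close>. Reading off their images gives phases for the vectors \<open>V x\<close>
  with which \<open>V\<close> becomes real linear on the orthogonal complement of \<open>e\<close>; it is then linear or
  conjugate linear, and extends to a map \<open>T\<close> of the whole space with
  \<open>outer (T x) = outer (V x)\<close> (\<open>semilinear_representative\<close>). As \<open>T\<close> preserves orthogonality, it is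
  a multiple of a unitary or antiunitary operator \<open>U\<close>.

  So \<open>f\<close> acts as \<open>A \<mapsto> l U A U\<^sup>*\<close> along rank one operators, which determine the rest: if
  \<open>A \<ge> B\<close> then, by the Cauchy-Schwarz inequality, \<open>A - B\<close> dominates a multiple of
  \<open>outer ((A - B) x)\<close> whose form agrees with that of \<open>A - B\<close> at \<open>x\<close>. This bounds \<open>f A - f B\<close>
  from below, and the same argument for the inverse of \<open>f\<close> bounds it from above (\<open>qf_image\<close>).
\<close>

section \<open>The inner product\<close>

lemma cinner_add_right: "cinner x (y + z) = cinner x y + cinner x (z::'a::complex_inner)"
  by (metis cinner_add_left cinner_commute complex_cnj_add)

lemma cinner_scaleC_right: "cinner x (c *\<^sub>C y) = cnj c * cinner x (y::'a::complex_inner)"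
  by (metis cinner_commute cinner_scaleC_left complex_cnj_mult)

lemma cinner_zero_left [simp]: "cinner 0 (x::'a::complex_inner) = 0"
  using cinner_diff_left[of x x x] by simp

lemma cinner_zero_right [simp]: "cinner (x::'a::complex_inner) 0 = 0"
  by (metis cinner_commute cinner_zero_left complex_cnj_zero)

lemma cinner_minus_left: "cinner (- x) y = - cinner x (y::'a::complex_inner)"
  using cinner_diff_left[of 0 x y] by simp

lemma cinner_minus_right: "cinner x (- y) = - cinner x (y::'a::complex_inner)"
  by (metis cinner_commute cinner_minus_left complex_cnj_minus)

lemma cinner_diff_right: "cinner x (y - z) = cinner x y - cinner x (z::'a::complex_inner)"
  using cinner_add_right[of x y "- z"] by (simp add: cinner_minus_right)

lemma cinner_scaleR_left: "cinner (r *\<^sub>R x) y = of_real r * cinner x (y::'a::complex_inner)"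
  by (simp add: scaleR_eq_scaleC cinner_scaleC_left)

lemma cinner_scaleR_right: "cinner x (r *\<^sub>R y) = of_real r * cinner x (y::'a::complex_inner)"
  by (simp add: scaleR_eq_scaleC cinner_scaleC_right)

lemmas cinner_simps = cinner_add_left cinner_add_right cinner_diff_left cinner_diff_right
  cinner_minus_left cinner_minus_right cinner_scaleC_left cinner_scaleC_right
  cinner_scaleR_left cinner_scaleR_right

lemma cinner_self: "cinner x x = of_real ((norm (x::'a::complex_inner))\<^sup>2)"
proof -
  have "Im (cinner x x) = 0"
    using cinner_commute[of x x] by (metis cnj.simps(2) equal_neg_zero)
  moreover have "Re (cinner x x) = (norm x)\<^sup>2"
    by (metis inner_eq_Re_cinner power2_norm_eq_inner)
  ultimately show ?thesis
    by (simp add: complex_eq_iff)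
qed

lemma cinner_self_eq_0 [simp]: "cinner x x = 0 \<longleftrightarrow> x = (0::'a::complex_inner)"
  by (simp add: cinner_self)

lemma cinner_eq_0_commute: "cinner x y = 0 \<longleftrightarrow> cinner y (x::'a::complex_inner) = 0"
  by (metis cinner_commute complex_cnj_zero)

lemma scaleC_one [simp]: "1 *\<^sub>C x = (x::'a::complex_inner)"
  by (rule complex_vector.scale_one)

lemma scaleC_zero_left [simp]: "0 *\<^sub>C x = (0::'a::complex_inner)"
  by (rule complex_vector.scale_zero_left)

lemma scaleC_zero_right [simp]: "c *\<^sub>C 0 = (0::'a::complex_inner)"
  by (rule complex_vector.scale_zero_right)

lemma scaleC_eq_0_iff [simp]: "c *\<^sub>C x = 0 \<longleftrightarrow> c = 0 \<or> x = (0::'a::complex_inner)"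
  by (rule complex_vector.scale_eq_0_iff)

lemma scaleC_scaleR_commute: "r *\<^sub>R c *\<^sub>C x = c *\<^sub>C r *\<^sub>R (x::'a::complex_inner)"
  by (simp add: scaleR_eq_scaleC scaleC_scaleC mult.commute)

lemma norm_scaleC: "norm (c *\<^sub>C x) = cmod c * norm (x::'a::complex_inner)"
proof -
  have "complex_of_real ((norm (c *\<^sub>C x))\<^sup>2) = c * cnj c * of_real ((norm x)\<^sup>2)"
    unfolding cinner_self[symmetric] by (simp add: cinner_simps)
  also have "\<dots> = of_real ((cmod c * norm x)\<^sup>2)"
    by (simp only: complex_norm_square power_mult_distrib of_real_mult)
  finally have "(norm (c *\<^sub>C x))\<^sup>2 = (cmod c * norm x)\<^sup>2"
    using of_real_eq_iff by blast
  then show ?thesis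
    by simp
qed

lemma orthogonal_decomposition:
  fixes x y :: "'a::complex_inner"
  obtains c z where "y = c *\<^sub>C x + z" "cinner x z = 0"
proof (cases "x = 0")
  case True
  then show ?thesis using that[of 0 y] by simp
next
  case False
  define c where "c = cinner y x / cinner x x"
  have "cinner (y - c *\<^sub>C x) x = 0"
    using False by (simp add: c_def cinner_simps)
  then show ?thesis
    using that[of c "y - c *\<^sub>C x"] cinner_eq_0_commute by auto
qed

text \<open>A vector is determined up to a scalar factor by its orthogonal complement.\<close>

lemma parallel_if_orthogonal:
  fixes x y :: "'a::complex_inner"
  assumes "\<And>z. cinner z y = 0 \<Longrightarrow> cinner z x = 0"
  obtains c where "x = c *\<^sub>C y"
proof -
  obtain c z where z: "x = c *\<^sub>C y + z" "cinner y z = 0"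
    by (rule orthogonal_decomposition)
  have "cinner z x = 0"
    using assms z(2) cinner_eq_0_commute by blast
  then have "cinner z z = 0"
    using z cinner_eq_0_commute[of y z] by (simp add: cinner_simps)
  then have "x = c *\<^sub>C y"
    using z(1) by simp
  then show ?thesis by (rule that)
qed

section \<open>The ordered vector space of bounded self-adjoint operators\<close>

lemma bounded_clinear_apply:
  assumes "bounded_clinear A"
  shows "A (x + y) = A x + A y" "A (c *\<^sub>C x) = c *\<^sub>C A x" "A (r *\<^sub>R x) = r *\<^sub>R A x"
  using assms unfolding bounded_clinear_def
  by (auto simp: linear_add linear_scale bounded_linear.linear)

text \<open>
  A type of its own gives the self-adjoint operators the structure of an ordered real vector space.
\<close>

typedef (overloaded) ('a::complex_inner) herm = "selfadjoint_ops :: ('a \<Rightarrow> 'a) set"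
  morphisms app Herm
proof
  show "(\<lambda>x. 0) \<in> (selfadjoint_ops :: ('a \<Rightarrow> 'a) set)"
    by (simp add: selfadjoint_ops_def bounded_clinear_def is_cadjoint_def bounded_linear_zero)
qed

setup_lifting type_definition_herm

definition qf :: "'a::complex_inner herm \<Rightarrow> 'a \<Rightarrow> real" where
  "qf A x = Re (cinner (app A x) x)"

lemma app_bounded_clinear: "bounded_clinear (app A)"
  and cinner_app_left: "cinner (app A x) y = cinner x (app A y)"
  using app[of A] by (auto simp: selfadjoint_ops_def is_cadjoint_def)

lemmas app_vector_simps = bounded_clinear_apply[OF app_bounded_clinear]

lemma cinner_app_self: "cinner (app A x) x = of_real (qf A x)"
proof -
  have "cnj (cinner (app A x) x) = cinner (app A x) x"
    by (metis cinner_app_left cinner_commute)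
  then show ?thesis
    unfolding qf_def by (metis of_real_Re Reals_cnj_iff)
qed

lemma qf_add_right: "qf A (x + y) = qf A x + qf A y + 2 * Re (cinner (app A x) y)"
  using cinner_commute[of "app A y" x]
  by (simp add: qf_def app_vector_simps cinner_simps cinner_app_left[of A x y])

text \<open>Polarization: the quadratic form determines the operator.\<close>

lemma herm_eqI:
  assumes "\<And>x. qf A x = qf B x"
  shows "A = B"
proof -
  have Re0: "Re (cinner (app A x - app B x) y) = 0" for x y
    using assms[of x] assms[of y] assms[of "x + y"] by (simp add: qf_add_right cinner_simps)
  have "app A x = app B x" for x
    using Re0[of x "app A x - app B x"] by (simp add: cinner_self)
  then show ?thesis
    by (metis app_inject ext)
qed

instantiation herm :: (complex_inner) real_vector
begin

lift_definition zero_herm :: "'a herm" is "\<lambda>x. 0"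
  by (simp add: selfadjoint_ops_def bounded_clinear_def is_cadjoint_def bounded_linear_zero)

lift_definition plus_herm :: "'a herm \<Rightarrow> 'a herm \<Rightarrow> 'a herm" is "\<lambda>A B x. A x + B x"
  by (auto simp: selfadjoint_ops_def bounded_clinear_def is_cadjoint_def cinner_simps
      scaleC_add_right intro: bounded_linear_add)

lift_definition minus_herm :: "'a herm \<Rightarrow> 'a herm \<Rightarrow> 'a herm" is "\<lambda>A B x. A x - B x"
  by (auto simp: selfadjoint_ops_def bounded_clinear_def is_cadjoint_def cinner_simps
      complex_vector.scale_right_diff_distrib intro: bounded_linear_sub)

lift_definition uminus_herm :: "'a herm \<Rightarrow> 'a herm" is "\<lambda>A x. - A x"
  by (auto simp: selfadjoint_ops_def bounded_clinear_def is_cadjoint_def cinner_simps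
      complex_vector.scale_minus_right intro: bounded_linear_minus)

lift_definition scaleR_herm :: "real \<Rightarrow> 'a herm \<Rightarrow> 'a herm" is "\<lambda>r A x. r *\<^sub>R A x"
  by (auto simp: selfadjoint_ops_def bounded_clinear_def is_cadjoint_def cinner_simps
      scaleC_scaleR_commute intro!: bounded_linear_const_scaleR)

instance
  by standard (transfer; auto simp: algebra_simps scaleR_add_right)+

end

lemma app_simps [simp]:
  "app 0 x = 0" "app (A + B) x = app A x + app B x" "app (A - B) x = app A x - app B x"
  "app (- A) x = - app A x" "app (r *\<^sub>R A) x = r *\<^sub>R app A x"
  by (transfer; simp)+

lemma qf_simps [simp]:
  "qf 0 x = 0" "qf (A + B) x = qf A x + qf B x" "qf (A - B) x = qf A x - qf B x"
  "qf (- A) x = - qf A x" "qf (r *\<^sub>R A) x = r * qf A x"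
  by (simp_all add: qf_def cinner_simps)

instantiation herm :: (complex_inner) order
begin

definition less_eq_herm :: "'a herm \<Rightarrow> 'a herm \<Rightarrow> bool" where
  "A \<le> B \<longleftrightarrow> (\<forall>x. qf A x \<le> qf B x)"

definition less_herm :: "'a herm \<Rightarrow> 'a herm \<Rightarrow> bool" where
  "less_herm A B \<longleftrightarrow> A \<le> B \<and> \<not> B \<le> A"

instance
proof
  show "A = B" if "A \<le> B" "B \<le> A" for A B :: "'a herm"
    using that by (intro herm_eqI) (auto simp: less_eq_herm_def intro: order_antisym)
qed (auto simp: less_eq_herm_def less_herm_def intro: order_trans)

end

instance herm :: (complex_inner) ordered_real_vector
  by standard (auto simp: less_eq_herm_def intro: mult_left_mono mult_right_mono)

lemma qf_scaleC: "qf A (c *\<^sub>C x) = (cmod c)\<^sup>2 * qf A x"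
proof -
  have "complex_of_real (qf A (c *\<^sub>C x)) = c * cnj c * of_real (qf A x)"
    unfolding cinner_app_self[symmetric] by (simp add: app_vector_simps cinner_simps)
  also have "\<dots> = of_real ((cmod c)\<^sup>2 * qf A x)"
    by (simp only: complex_norm_square of_real_mult)
  finally show ?thesis
    using of_real_eq_iff by blast
qed

text \<open>Any two operators have a common upper bound, namely a large scalar operator.\<close>

lemma herm_upper_bound:
  obtains C where "A \<le> C" "(B::'a::complex_inner herm) \<le> C"
proof -
  have bound: "\<exists>r. \<forall>x. qf A x \<le> r * (norm x)\<^sup>2" for A :: "'a herm"
  proof -
    obtain K where K: "\<And>x. norm (app A x) \<le> norm x * K"
      using app_bounded_clinear[of A] bounded_linear.bounded
      unfolding bounded_clinear_def by blast
    have "qf A x \<le> K * (norm x)\<^sup>2" for x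
    proof -
      have "qf A x = inner (app A x) x"
        by (simp add: qf_def inner_eq_Re_cinner)
      also have "\<dots> \<le> norm (app A x) * norm x"
        by (rule norm_cauchy_schwarz)
      also have "\<dots> \<le> norm x * K * norm x"
        by (intro mult_right_mono K) simp
      finally show ?thesis
        by (simp add: power2_eq_square mult.commute mult.left_commute)
    qed
    then show ?thesis by blast
  qed
  obtain r s where rs: "\<And>x. qf A x \<le> r * (norm x)\<^sup>2" "\<And>x. qf B x \<le> s * (norm x)\<^sup>2"
    using bound by meson
  define I :: "'a herm" where "I = Herm (\<lambda>x. x)"
  have "app I = (\<lambda>x. x)"
    unfolding I_def
    by (rule Herm_inverse)
       (simp add: selfadjoint_ops_def bounded_clinear_def is_cadjoint_def bounded_linear_ident)
  then have I: "qf I x = (norm x)\<^sup>2" for x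
    by (simp add: qf_def cinner_self)
  have "A \<le> (max r s) *\<^sub>R I" "B \<le> (max r s) *\<^sub>R I"
    unfolding less_eq_herm_def qf_simps I
    by (meson rs order_trans mult_right_mono max.cobounded1 max.cobounded2 zero_le_power2)+
  then show ?thesis by (rule that)
qed

section \<open>Operators of rank one\<close>

lift_definition outer :: "'a::complex_inner \<Rightarrow> 'a herm" is "\<lambda>x z. cinner z x *\<^sub>C x"
proof -
  fix x :: 'a
  have "bounded_linear (\<lambda>z. cinner z x *\<^sub>C x)"
  proof (rule bounded_linear_intro[where K = "norm x * norm x"])
    fix z
    have "cmod (cinner z x) \<le> norm z * norm x"
    proof (cases "cinner z x = 0")
      case False
      define w where "w = cinner z x"
      have "cinner z (w *\<^sub>C x) = of_real ((cmod w)\<^sup>2)"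
        by (simp only: cinner_scaleC_right complex_norm_square w_def mult.commute)
      then have "(cmod w)\<^sup>2 = Re (cinner z (w *\<^sub>C x))"
        by simp
      also have "\<dots> \<le> norm z * norm (w *\<^sub>C x)"
        by (metis inner_eq_Re_cinner norm_cauchy_schwarz)
      finally have "cmod w * cmod w \<le> cmod w * (norm z * norm x)"
        by (simp add: norm_scaleC power2_eq_square algebra_simps)
      then show ?thesis
        using False by (simp add: w_def)
    qed simp
    then show "norm (cinner z x *\<^sub>C x) \<le> norm z * (norm x * norm x)"
      by (metis mult.assoc mult_right_mono norm_ge_zero norm_scaleC)
  qed (simp_all add: cinner_simps scaleC_add_left scaleR_eq_scaleC scaleC_scaleC)
  moreover have "cinner z x * cinner x y = cnj (cinner y x) * cinner z x" for y z
    using cinner_commute[of x y] by (simp add: mult.commute)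
  ultimately show "(\<lambda>z. cinner z x *\<^sub>C x) \<in> selfadjoint_ops"
    unfolding selfadjoint_ops_def bounded_clinear_def is_cadjoint_def mem_Collect_eq
    by (simp only: cinner_simps scaleC_scaleC simp_thms)
qed

lemma app_outer: "app (outer x) z = cinner z x *\<^sub>C x"
  by transfer simp

lemma qf_outer: "qf (outer x) z = (cmod (cinner z x))\<^sup>2"
proof -
  have "cinner (app (outer x) z) z = of_real ((cmod (cinner z x))\<^sup>2)"
    using cinner_commute[of x z]
    by (simp only: app_outer cinner_scaleC_left complex_norm_square)
  then show ?thesis by (simp add: qf_def)
qed

lemma outer_zero [simp]: "outer 0 = 0"
  by (intro herm_eqI) (simp add: qf_outer)

lemma outer_eq_0_iff [simp]: "outer x = 0 \<longleftrightarrow> x = 0"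
proof
  assume "outer x = 0"
  then have "qf (outer x) x = 0" by simp
  then show "x = 0" by (simp add: qf_outer)
qed simp

lemma outer_nonneg: "0 \<le> outer x"
  by (simp add: less_eq_herm_def qf_outer)

lemma outer_scaleC: "outer (c *\<^sub>C x) = (cmod c)\<^sup>2 *\<^sub>R outer x"
  by (intro herm_eqI) (simp add: qf_outer cinner_simps norm_mult power_mult_distrib)

lemma outer_scaleR: "outer (r *\<^sub>R x) = r\<^sup>2 *\<^sub>R outer x"
  by (simp add: scaleR_eq_scaleC outer_scaleC)

lemma scaleR_outer: "0 \<le> s \<Longrightarrow> s *\<^sub>R outer x = outer (sqrt s *\<^sub>R x)"
  by (simp add: outer_scaleR)

lemma outer_parallel:
  assumes "outer x = t *\<^sub>R outer y"
  obtains c where "x = c *\<^sub>C y"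
proof (rule parallel_if_orthogonal[of y x])
  fix z assume "cinner z y = 0"
  then have "qf (outer x) z = 0" by (simp add: assms qf_outer)
  then show "cinner z x = 0" by (simp add: qf_outer)
qed

lemma cmod_add_squared: "(cmod (a + b))\<^sup>2 = (cmod a)\<^sup>2 + (cmod b)\<^sup>2 + 2 * Re (a * cnj b)"
  unfolding cmod_power2 by (simp add: power2_eq_square algebra_simps)

lemma qf_outer_add:
  "qf (outer (e + x)) z = qf (outer e) z + qf (outer x) z + 2 * Re (cinner z e * cnj (cinner z x))"
  by (simp add: qf_outer cinner_simps cmod_add_squared)

section \<open>Order intervals that are chains\<close>

lemma nonneg_qf_eq_0:
  assumes "0 \<le> D" "qf D x = 0"
  shows "app D x = 0"
proof (rule ccontr)
  assume "app D x \<noteq> 0"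
  define y where "y = app D x"
  have y: "0 < (norm y)\<^sup>2" using \<open>app D x \<noteq> 0\<close> by (simp add: y_def)
  have "qf D (t *\<^sub>R x + y) = 2 * t * (norm y)\<^sup>2 + qf D y" for t :: real
    using assms(2) cinner_app_left[of D y x]
    by (simp add: qf_def app_vector_simps cinner_simps cinner_self flip: y_def)
  moreover have "0 \<le> qf D (t *\<^sub>R x + y)" for t :: real
    using assms(1) by (simp add: less_eq_herm_def)
  ultimately have "0 \<le> 2 * t * (norm y)\<^sup>2 + qf D y" for t :: real
    by metis
  from this[of "- (qf D y + 1) / (2 * (norm y)\<^sup>2)"] y show False
    by (simp add: field_simps)
qed

text \<open>
  By the Cauchy-Schwarz inequality for the form of \<open>D\<close>, this is the largest multiple of
  \<open>outer (app D x)\<close> below \<open>D\<close>; its form agrees with that of \<open>D\<close> at \<open>x\<close>.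
\<close>

lemma outer_le_nonneg:
  assumes "0 \<le> D" "0 < qf D x"
  shows "(1 / qf D x) *\<^sub>R outer (app D x) \<le> D"
  unfolding less_eq_herm_def
proof
  fix z
  define a where "a = cinner z (app D x) / of_real (qf D x)"
  have eq: "cinner z (app D x) = a * of_real (qf D x)"
    using assms(2) by (simp add: a_def)
  have "0 \<le> qf D (z + (- a) *\<^sub>C x)"
    using assms(1) by (simp add: less_eq_herm_def)
  also have "\<dots> = qf D z - (cmod a)\<^sup>2 * qf D x"
  proof -
    have "cinner (app D z) ((- a) *\<^sub>C x) = - (a * cnj a * of_real (qf D x))"
      by (simp add: cinner_app_left eq cinner_simps app_vector_simps mult.commute mult.left_commute)
    also have "\<dots> = of_real (- ((cmod a)\<^sup>2 * qf D x))"
      by (simp only: complex_norm_square of_real_mult of_real_minus)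
    finally show ?thesis
      by (simp only: qf_add_right qf_scaleC norm_minus_cancel Re_complex_of_real)
  qed
  finally show "qf ((1 / qf D x) *\<^sub>R outer (app D x)) z \<le> qf D z"
    using assms(2) by (simp add: qf_outer eq norm_mult power_mult_distrib power2_eq_square)
qed

lemma qf_outer_app:
  "qf (outer (app D x)) x = (qf D x)\<^sup>2"
  using cinner_app_self[of D x] by (simp add: qf_outer flip: cinner_app_left)

text \<open>The form of \<open>D\<close>, and with it \<open>D\<close>, vanishes on the orthogonal complement of \<open>x\<close>.\<close>

lemma le_outer_imp_multiple:
  assumes "0 \<le> D" "D \<le> outer x"
  obtains s where "D = s *\<^sub>R outer x"
proof (cases "x = 0")
  case True
  then have "D = 0" using assms by (simp add: order_antisym)
  with that[of 0] show ?thesis by simp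
next
  case False
  have ann: "app D z = 0" if "cinner x z = 0" for z
  proof (rule nonneg_qf_eq_0[OF assms(1)])
    have "qf D z \<le> qf (outer x) z" "0 \<le> qf D z"
      using assms by (auto simp: less_eq_herm_def)
    then show "qf D z = 0"
      using that cinner_eq_0_commute[of x z] by (simp add: qf_outer)
  qed
  have "qf D z = qf ((qf D x / (norm x)^4) *\<^sub>R outer x) z" for z
  proof -
    obtain c w where w: "z = c *\<^sub>C x + w" "cinner x w = 0"
      by (rule orthogonal_decomposition)
    have "app D z = c *\<^sub>C app D x"
      using ann[OF w(2)] by (simp add: w(1) app_vector_simps)
    moreover have "cinner (app D x) w = 0"
      using ann[OF w(2)] by (simp add: cinner_app_left)
    ultimately have "qf D z = qf D (c *\<^sub>C x)"
      by (simp add: qf_def app_vector_simps cinner_simps w(1))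
    moreover have "cinner z x = c * of_real ((norm x)\<^sup>2)"
      using w cinner_eq_0_commute[of x w] by (simp add: cinner_simps cinner_self)
    ultimately show ?thesis
      using False
      by (simp add: qf_scaleC qf_outer norm_mult norm_power power_mult_distrib flip: power_mult)
  qed
  then show ?thesis
    by (intro that herm_eqI)
qed

text \<open>
  This describes rank one differences in terms of the order alone.
  Below \<open>outer x\<close> there are only its multiples. Conversely, a chain \<open>[0, D]\<close> with \<open>qf D x > 0\<close>
  contains the rank one operator \<open>G\<close> of \<open>outer_le_nonneg\<close> and \<open>D - G\<close>. As \<open>qf (D - G) x = 0\<close>,
  it is \<open>D - G\<close> that is the smaller of the two, and so it is a multiple of \<open>G\<close>.
\<close>

lemma chain_iff_rank_one:
  assumes "A \<le> B"
  shows "(\<exists>x. B = A + outer x) \<longleftrightarrow>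
    (\<forall>C D. A \<le> C \<and> C \<le> B \<and> A \<le> D \<and> D \<le> B \<longrightarrow> C \<le> D \<or> D \<le> C)"
    (is "?L \<longleftrightarrow> ?R")
proof
  assume ?L
  then obtain x where x: "B = A + outer x" by blast
  show ?R
  proof (intro allI impI)
    fix C D assume *: "A \<le> C \<and> C \<le> B \<and> A \<le> D \<and> D \<le> B"
    have "\<exists>s. C - A = s *\<^sub>R outer x" "\<exists>s. D - A = s *\<^sub>R outer x"
      using * le_outer_imp_multiple[of "C - A" x] le_outer_imp_multiple[of "D - A" x]
      by (metis x add_le_cancel_left add_diff_cancel_left' diff_add_cancel add.commute diff_ge_0_iff_ge)+
    then obtain r s where "C - A = r *\<^sub>R outer x" "D - A = s *\<^sub>R outer x"
      by blast
    then have "C = A + r *\<^sub>R outer x" "D = A + s *\<^sub>R outer x"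
      by (simp_all add: algebra_simps)
    then show "C \<le> D \<or> D \<le> C"
      by (metis add_le_cancel_left linear outer_nonneg scaleR_right_mono)
  qed
next
  assume chain: ?R
  define D where "D = B - A"
  have D: "0 \<le> D" using assms by (simp add: D_def)
  show ?L
  proof (cases "\<exists>x. 0 < qf D x")
    case False
    then have "D = 0"
      using D by (intro antisym) (auto simp: less_eq_herm_def not_less)
    then have "B = A + outer 0" by (simp add: D_def)
    then show ?thesis by blast
  next
    case True
    then obtain x where x: "0 < qf D x" by blast
    define G where "G = (1 / qf D x) *\<^sub>R outer (app D x)"
    have G: "0 \<le> G" "G \<le> D"
      using x outer_le_nonneg[OF D x]
      by (auto simp: G_def intro!: scaleR_nonneg_nonneg outer_nonneg)
    have Gx: "qf G x = qf D x"
      using x by (simp add: G_def qf_outer_app power2_eq_square)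
    have "A + G \<le> A + (D - G) \<or> A + (D - G) \<le> A + G"
    proof (rule chain[rule_format], intro conjI)
      show "A + G \<le> B" using add_left_mono[OF G(2), of A] by (simp add: D_def)
      show "A + (D - G) \<le> B" using add_left_mono[OF G(1), of "B - G"] by (simp add: D_def algebra_simps)
    qed (use G in simp_all)
    moreover have "\<not> G \<le> D - G"
      using Gx x by (auto simp: less_eq_herm_def intro!: exI[of _ x])
    ultimately have "D - G \<le> G"
      by simp
    have Gout: "G = outer (sqrt (1 / qf D x) *\<^sub>R app D x)"
      using x by (simp add: G_def scaleR_outer)
    obtain s where "D - G = s *\<^sub>R G"
      using le_outer_imp_multiple[of "D - G"] \<open>D - G \<le> G\<close> G Gout
      by (metis diff_ge_0_iff_ge)
    then have DG: "D = (1 + s) *\<^sub>R G"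
      by (simp add: algebra_simps)
    have "s \<ge> 0"
    proof -
      have "qf D x = (1 + s) * qf D x"
        using Gx DG by (metis qf_simps(5))
      then show ?thesis using x by simp
    qed
    then have "D = outer (sqrt (1 + s) *\<^sub>R sqrt (1 / qf D x) *\<^sub>R app D x)"
      using DG Gout by (simp add: scaleR_outer)
    then have "B = A + outer (sqrt (1 + s) *\<^sub>R sqrt (1 / qf D x) *\<^sub>R app D x)"
      by (simp add: D_def algebra_simps)
    then show ?thesis by blast
  qed
qed

section \<open>Order automorphisms are affine along rank one operators\<close>

lemma scaleR_outer_le_iff:
  assumes "x \<noteq> 0"
  shows "s *\<^sub>R outer x \<le> t *\<^sub>R outer x \<longleftrightarrow> s \<le> t"
proof
  assume "s *\<^sub>R outer x \<le> t *\<^sub>R outer x"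
  then have "qf (s *\<^sub>R outer x) x \<le> qf (t *\<^sub>R outer x) x"
    by (simp only: less_eq_herm_def)
  then show "s \<le> t"
    using assms by (simp add: qf_outer)
qed (intro scaleR_right_mono outer_nonneg)

text \<open>
  The difference to the linear map is additive and has period one, so it is bounded, and a bounded
  additive map is zero.
\<close>

lemma additive_mono_imp_linear:
  fixes g :: "real \<Rightarrow> real"
  assumes add: "\<And>s t. g (s + t) = g s + g t" and mono: "\<And>s t. s \<le> t \<Longrightarrow> g s \<le> g t"
  shows "g t = t * g 1"
proof (rule ccontr)
  define h where "h t = g t - t * g 1" for t
  have h_add: "h (s + t) = h s + h t" for s t
    by (simp add: h_def add algebra_simps)
  have h0: "h 0 = 0" using h_add[of 0 0] by simp
  have h_mult: "h (real n * t) = real n * h t" for n t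
    by (induction n) (simp_all add: h0 h_add algebra_simps)
  have h_neg: "h (- t) = - h t" for t
    using h_add[of t "- t"] h0 by simp
  have h_nat: "h (real n) = 0" for n
    using h_mult[of n 1] by (simp add: h_def)
  have h_int: "h (of_int k) = 0" for k
    by (cases k rule: int_cases2) (simp_all add: h_nat h_neg)
  have "\<bar>h t\<bar> \<le> g 1" for t
  proof -
    have "h t = h (frac t)"
      using h_add[of "of_int \<lfloor>t\<rfloor>" "frac t"] h_int by (simp add: frac_def)
    moreover have "0 \<le> g (frac t)" "g (frac t) \<le> g 1"
      using mono[of 0 "frac t"] mono[of "frac t" 1] frac_lt_1[of t] add[of 0 0]
      by (simp_all add: frac_ge_0)
    moreover have "0 \<le> frac t * g 1" "frac t * g 1 \<le> g 1"
      using mono[of 0 1] frac_lt_1[of t] add[of 0 0] mult_right_mono[of "frac t" 1 "g 1"]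
      by (auto simp: frac_ge_0)
    ultimately show ?thesis
      unfolding h_def abs_le_iff by linarith
  qed
  then have bound: "real n * \<bar>h t\<bar> \<le> g 1" for n
    by (metis h_mult abs_mult abs_of_nat)
  assume "g t \<noteq> t * g 1"
  then have "0 < \<bar>h t\<bar>" by (simp add: h_def)
  then obtain n where "g 1 < real n * \<bar>h t\<bar>"
    using reals_Archimedean3 by blast
  with bound[of n] show False by simp
qed

locale order_automorphism =
  fixes f :: "'a::complex_inner herm \<Rightarrow> 'a herm"
  assumes bij: "bij f" and order: "f A \<le> f B \<longleftrightarrow> A \<le> B"
begin

lemma inj_iff: "f A = f B \<longleftrightarrow> A = B"
  using bij by (metis bij_pointE)

lemma inv_f [simp]: "inv f (f A) = A" "f (inv f A) = A"
  using bij by (simp_all add: bij_is_inj bij_is_surj surj_f_inv_f)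

lemma inverse: "order_automorphism (inv f)"
proof
  show "bij (inv f)" using bij by (rule bij_imp_bij_inv)
  show "inv f A \<le> inv f B \<longleftrightarrow> A \<le> B" for A B
    using order[of "inv f A" "inv f B"] by simp
qed

lemma image_add_outer: "\<exists>y. f (A + outer x) = f A + outer y"
proof -
  have le: "A \<le> A + outer x" by (simp add: outer_nonneg)
  then have "C \<le> D \<or> D \<le> C"
    if "f A \<le> C" "C \<le> f (A + outer x)" "f A \<le> D" "D \<le> f (A + outer x)" for C D
    using chain_iff_rank_one[OF le] that by (metis inv_f(2) order)
  then show ?thesis
    using chain_iff_rank_one[of "f A" "f (A + outer x)"] le order by blast
qed

text \<open>
  Any three points of the line lie in an interval \<open>[B, B + outer (c *\<^sub>R x)]\<close>, whose image is an
  interval of the same kind and hence contained in a line.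
\<close>

lemma image_line:
  assumes "x \<noteq> 0"
  obtains y where "y \<noteq> 0" "\<And>t. \<exists>s. f (A + t *\<^sub>R outer x) = f A + s *\<^sub>R outer y"
proof -
  obtain y where y: "f (A + outer x) = f A + outer y"
    using image_add_outer by blast
  have "y \<noteq> 0"
    using y assms inj_iff[of "A + outer x" A] by auto
  moreover have "\<exists>s. f (A + t *\<^sub>R outer x) = f A + s *\<^sub>R outer y" for t
  proof -
    define p where "p r = A + r *\<^sub>R outer x" for r
    define lo hi where "lo = min 0 t" and "hi = max 1 t"
    have "p hi = p lo + (hi - lo) *\<^sub>R outer x"
      by (simp add: p_def algebra_simps)
    also have "\<dots> = p lo + outer (sqrt (hi - lo) *\<^sub>R x)"
      by (simp add: scaleR_outer lo_def hi_def)
    finally obtain u where u: "f (p hi) = f (p lo) + outer u"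
      using image_add_outer by metis
    have "\<exists>s. f (p r) = f (p lo) + s *\<^sub>R outer u" if "lo \<le> r" "r \<le> hi" for r
    proof -
      have "f (p lo) \<le> f (p r)" "f (p r) \<le> f (p hi)"
        using that unfolding order p_def by (simp_all add: scaleR_outer_le_iff assms)
      then obtain s where "f (p r) - f (p lo) = s *\<^sub>R outer u"
        using le_outer_imp_multiple[of "f (p r) - f (p lo)" u] u
        by (auto simp: algebra_simps)
      then show ?thesis by (auto simp: algebra_simps)
    qed
    then obtain s0 s1 st where s: "f (p 0) = f (p lo) + s0 *\<^sub>R outer u"
      "f (p 1) = f (p lo) + s1 *\<^sub>R outer u" "f (p t) = f (p lo) + st *\<^sub>R outer u"
      unfolding lo_def hi_def
      by (metis max.cobounded1 max.cobounded2 min.cobounded1 min.cobounded2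
          min.coboundedI1 zero_le_one max.coboundedI1)
    have "outer y = f (p 1) - f (p 0)"
      using y by (simp add: p_def)
    also have "\<dots> = (s1 - s0) *\<^sub>R outer u"
      by (simp add: s algebra_simps)
    finally have oy: "outer y = (s1 - s0) *\<^sub>R outer u" .
    then have "s1 \<noteq> s0" using \<open>y \<noteq> 0\<close> by auto
    have "f (p t) = f (p 0) + (st - s0) *\<^sub>R outer u"
      by (simp add: s algebra_simps)
    also have "(st - s0) *\<^sub>R outer u = ((st - s0) / (s1 - s0)) *\<^sub>R outer y"
      using \<open>s1 \<noteq> s0\<close> by (simp add: oy)
    finally show ?thesis by (auto simp: p_def)
  qed
  ultimately show ?thesis by (rule that)
qed

text \<open>The inverse maps the image line back into a line, which has to be the original one.\<close>

lemma image_line_onto: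
  assumes "x \<noteq> 0"
  obtains y g where "y \<noteq> 0" "surj g" "\<And>t. f (A + t *\<^sub>R outer x) = f A + g t *\<^sub>R outer y"
proof -
  interpret inverse: order_automorphism "inv f" by (rule inverse)
  obtain y where y: "y \<noteq> 0" "\<And>t. \<exists>s. f (A + t *\<^sub>R outer x) = f A + s *\<^sub>R outer y"
    using image_line[OF assms] by blast
  then obtain g where g: "\<And>t. f (A + t *\<^sub>R outer x) = f A + g t *\<^sub>R outer y"
    by metis
  obtain w where w: "\<And>s. \<exists>t. inv f (f A + s *\<^sub>R outer y) = A + t *\<^sub>R outer w"
    using inverse.image_line[OF y(1), of "f A"] by (metis inv_f(1))
  obtain t1 where "A + 1 *\<^sub>R outer x = A + t1 *\<^sub>R outer w"
    using w[of "g 1"] by (metis g inv_f(1))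
  then have t1: "outer x = t1 *\<^sub>R outer w" by simp
  then have "t1 \<noteq> 0" using assms by auto
  have "\<exists>t. s = g t" for s
  proof -
    obtain t where "inv f (f A + s *\<^sub>R outer y) = A + t *\<^sub>R outer w"
      using w by blast
    also have "\<dots> = A + (t / t1) *\<^sub>R outer x"
      using \<open>t1 \<noteq> 0\<close> by (simp add: t1)
    finally have "f A + s *\<^sub>R outer y = f A + g (t / t1) *\<^sub>R outer y"
      by (metis g inv_f(2))
    then show ?thesis using y(1) by auto
  qed
  then have "surj g" by (auto simp: surj_def)
  with y g that show ?thesis by blast
qed

text \<open>
  The two parallel lines \<open>A + t outer x \<le> B + t outer x\<close> have images that are comparable for each
  \<open>t\<close>. Where the form of the image direction at \<open>B\<close> vanishes, the one at \<open>A\<close> has to vanish as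
  well, since its coefficient takes arbitrarily large values.
\<close>

lemma image_directions_parallel:
  assumes "A \<le> B" and "surj g"
    and A: "\<And>t. f (A + t *\<^sub>R outer x) = f A + g t *\<^sub>R outer y"
    and B: "\<And>t. f (B + t *\<^sub>R outer x) = f B + h t *\<^sub>R outer y'"
  obtains c where "y = c *\<^sub>C y'"
proof (rule parallel_if_orthogonal[of y' y])
  fix z assume z: "cinner z y' = 0"
  show "cinner z y = 0"
  proof (rule ccontr)
    assume "cinner z y \<noteq> 0"
    then have pos: "0 < qf (outer y) z" by (simp add: qf_outer)
    obtain t where t: "g t = (qf (f B) z - qf (f A) z + 1) / qf (outer y) z"
      using \<open>surj g\<close> by (metis surjD)
    have "f (A + t *\<^sub>R outer x) \<le> f (B + t *\<^sub>R outer x)"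
      using \<open>A \<le> B\<close> by (simp add: order)
    then have "qf (f A) z + g t * qf (outer y) z \<le> qf (f B) z + h t * qf (outer y') z"
      unfolding A B less_eq_herm_def by simp
    then show False
      using z pos by (simp add: t qf_outer)
  qed
qed

text \<open>
  The direction of the image line does not depend on the base point, because any two base points
  have a common upper bound.
\<close>

lemma image_direction:
  assumes "x \<noteq> 0"
  shows "\<exists>d. d \<noteq> 0 \<and> (\<forall>A. \<exists>g. surj g \<and> (\<forall>t. f (A + t *\<^sub>R outer x) = f A + g t *\<^sub>R outer d))"
proof -
  obtain d g0 where d: "d \<noteq> 0" "surj g0"
    "\<And>t. f (0 + t *\<^sub>R outer x) = f 0 + g0 t *\<^sub>R outer d"
    using image_line_onto[OF assms, of 0] by blast
  have "\<exists>g. surj g \<and> (\<forall>t. f (A + t *\<^sub>R outer x) = f A + g t *\<^sub>R outer d)" for A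
  proof -
    obtain y g where y: "y \<noteq> 0" "surj g"
      "\<And>t. f (A + t *\<^sub>R outer x) = f A + g t *\<^sub>R outer y"
      using image_line_onto[OF assms, of A] by blast
    obtain C where C: "A \<le> C" "0 \<le> C" by (rule herm_upper_bound)
    obtain u h where u: "u \<noteq> 0" "surj h"
      "\<And>t. f (C + t *\<^sub>R outer x) = f C + h t *\<^sub>R outer u"
      using image_line_onto[OF assms, of C] by blast
    obtain a where a: "y = a *\<^sub>C u"
      by (rule image_directions_parallel[OF C(1) y(2,3) u(3)])
    obtain b where b: "d = b *\<^sub>C u"
      by (rule image_directions_parallel[OF C(2) d(2,3) u(3)])
    define k where "k = (cmod a)\<^sup>2 / (cmod b)\<^sup>2"
    have "a \<noteq> 0" "b \<noteq> 0" using y(1) d(1) a b by auto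
    then have "k \<noteq> 0" and k: "outer y = k *\<^sub>R outer d"
      by (auto simp: k_def a b outer_scaleC)
    have "surj (\<lambda>t. g t * k)"
      unfolding surj_def using \<open>k \<noteq> 0\<close> y(2) by (metis nonzero_eq_divide_eq surjD)
    moreover have "f (A + t *\<^sub>R outer x) = f A + (g t * k) *\<^sub>R outer d" for t
      by (simp add: y(3) k)
    ultimately show ?thesis by (intro exI[of _ "\<lambda>t. g t * k"]) blast
  qed
  with d(1) show ?thesis by blast
qed

definition dir :: "'a \<Rightarrow> 'a" where
  "dir x = (SOME d. d \<noteq> 0 \<and>
    (\<forall>A. \<exists>g. surj g \<and> (\<forall>t. f (A + t *\<^sub>R outer x) = f A + g t *\<^sub>R outer d)))"

definition coef :: "'a herm \<Rightarrow> 'a \<Rightarrow> real \<Rightarrow> real" where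
  "coef A x t = (SOME s. f (A + t *\<^sub>R outer x) = f A + s *\<^sub>R outer (dir x))"

context
  fixes x :: 'a
  assumes x: "x \<noteq> 0"
begin

lemma dir_nonzero: "dir x \<noteq> 0"
  and dir_line: "\<exists>g. surj g \<and> (\<forall>t. f (A + t *\<^sub>R outer x) = f A + g t *\<^sub>R outer (dir x))"
  using someI_ex[OF image_direction[OF x]] unfolding dir_def[symmetric] by blast+

lemma coef_eqI:
  assumes "f (A + t *\<^sub>R outer x) = f A + s *\<^sub>R outer (dir x)"
  shows "coef A x t = s"
  unfolding coef_def using assms dir_nonzero by (intro some_equality) auto

lemma coef: "f (A + t *\<^sub>R outer x) = f A + coef A x t *\<^sub>R outer (dir x)"
  using dir_line[of A] coef_eqI by metis

lemma coef_surj: "surj (coef A x)"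
proof -
  obtain g where g: "surj g" "\<And>t. f (A + t *\<^sub>R outer x) = f A + g t *\<^sub>R outer (dir x)"
    using dir_line by blast
  then have "coef A x = g" using coef_eqI by blast
  with g show ?thesis by simp
qed

lemma coef_le_iff: "coef A x s \<le> coef A x t \<longleftrightarrow> s \<le> t"
  using order[of "A + s *\<^sub>R outer x" "A + t *\<^sub>R outer x"]
  by (simp add: coef scaleR_outer_le_iff x dir_nonzero)

lemma coef_zero: "coef A x 0 = 0"
  by (rule coef_eqI) simp

lemma independent_nonzero: "(\<And>c. y \<noteq> c *\<^sub>C x) \<Longrightarrow> y \<noteq> 0"
  using complex_vector.scale_zero_left by metis

text \<open>
  If \<open>dir x\<close> and \<open>dir y\<close> were parallel, the lines through \<open>0\<close> along \<open>outer x\<close> and \<open>outer y\<close> would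
  have the same image.
\<close>

lemma outer_dir_independent:
  assumes y: "\<And>c. y \<noteq> c *\<^sub>C x" and eq: "a *\<^sub>R outer (dir x) = b *\<^sub>R outer (dir y)"
  shows "a = 0"
proof -
  have "y \<noteq> 0" by (rule independent_nonzero[OF y])
  have "\<exists>z. cinner z (dir x) = 0 \<and> cinner z (dir y) \<noteq> 0"
  proof (rule ccontr)
    assume "\<not> ?thesis"
    then obtain c where c: "dir y = c *\<^sub>C dir x"
      using parallel_if_orthogonal[of "dir x" "dir y"] by blast
    obtain t where t: "coef 0 x t = coef 0 y 1 * (cmod c)\<^sup>2"
      using coef_surj by (metis surjD)
    have "f (0 + 1 *\<^sub>R outer y) = f (0 + t *\<^sub>R outer x)"
      unfolding coef order_automorphism.coef[OF order_automorphism_axioms \<open>y \<noteq> 0\<close>] t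
      by (simp add: c outer_scaleC)
    then have "outer y = t *\<^sub>R outer x"
      by (simp add: inj_iff)
    then show False using y outer_parallel by metis
  qed
  then obtain z where z: "cinner z (dir x) = 0" "cinner z (dir y) \<noteq> 0" by blast
  have "qf (a *\<^sub>R outer (dir x)) z = qf (b *\<^sub>R outer (dir y)) z"
    by (simp only: eq)
  then have "b = 0" using z by (simp add: qf_outer)
  with eq dir_nonzero show ?thesis by simp
qed

text \<open>
  The point \<open>f (A + s outer y + t outer x)\<close> can be reached from \<open>f A\<close> along two sides of a
  parallelogram, in either order.
\<close>

lemma coef_shift:
  assumes y: "\<And>c. y \<noteq> c *\<^sub>C x"
  shows "coef (A + s *\<^sub>R outer y) x t = coef A x t"
proof -
  have "y \<noteq> 0" by (rule independent_nonzero[OF y])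
  note coef_y = order_automorphism.coef[OF order_automorphism_axioms \<open>y \<noteq> 0\<close>]
  have "f (A + s *\<^sub>R outer y + t *\<^sub>R outer x) = f (A + t *\<^sub>R outer x + s *\<^sub>R outer y)"
    by (simp add: algebra_simps)
  then have "(coef (A + s *\<^sub>R outer y) x t - coef A x t) *\<^sub>R outer (dir x)
      = (coef (A + t *\<^sub>R outer x) y s - coef A y s) *\<^sub>R outer (dir y)"
    unfolding coef coef_y by (simp add: algebra_simps)
  then show ?thesis
    using outer_dir_independent[OF y] by fastforce
qed

end

lemma outer_parallelogram:
  "outer (x + y) + outer (x - y) = 2 *\<^sub>R outer x + 2 *\<^sub>R outer y"
  using qf_outer_add[of x y] qf_outer_add[of x "- y"]
  by (intro herm_eqI) (simp add: qf_outer cinner_simps)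

end

text \<open>
  In dimension one the operators are the real numbers, all of whose increasing bijections are order
  automorphisms, so a second dimension is indispensable from here on.
\<close>

locale order_automorphism_dim2 = order_automorphism f
  for f :: "'a::complex_inner herm \<Rightarrow> 'a herm" +
  assumes dim: "\<exists>y. \<forall>c. y \<noteq> c *\<^sub>C (x::'a)"
begin

text \<open>
  By the parallelogram law, a multiple of \<open>outer x\<close> is a combination of operators \<open>outer y\<close> with \<open>y\<close>
  independent of \<open>x\<close>.
\<close>

lemma coef_shift_self:
  assumes x: "x \<noteq> 0"
  shows "coef (A + s *\<^sub>R outer x) x t = coef A x t"
proof -
  obtain y where y: "\<And>c. y \<noteq> c *\<^sub>C x" using dim by blast
  have xy: "x + y \<noteq> c *\<^sub>C x" "x - y \<noteq> c *\<^sub>C x" for c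
  proof -
    show "x + y \<noteq> c *\<^sub>C x"
      using y[of "c - 1"] by (auto simp: complex_vector.scale_left_diff_distrib algebra_simps)
    show "x - y \<noteq> c *\<^sub>C x"
      using y[of "1 - c"] by (auto simp: complex_vector.scale_left_diff_distrib algebra_simps)
  qed
  have "(s / 2) *\<^sub>R (outer (x + y) + outer (x - y)) = s *\<^sub>R outer x + s *\<^sub>R outer y"
    unfolding outer_parallelogram by (simp add: algebra_simps)
  then have "A + s *\<^sub>R outer x
      = A + (- s) *\<^sub>R outer y + (s / 2) *\<^sub>R outer (x + y) + (s / 2) *\<^sub>R outer (x - y)"
    by (simp add: algebra_simps)
  then show ?thesis
    by (simp only: coef_shift[OF x xy(1)] coef_shift[OF x xy(2)] coef_shift[OF x y])
qed

lemma coef_linear: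
  assumes x: "x \<noteq> 0"
  shows "coef A x t = t * coef A x 1"
proof (rule additive_mono_imp_linear)
  show "coef A x (s + t) = coef A x s + coef A x t" for s t
  proof (rule coef_eqI[OF x])
    have "f (A + (s + t) *\<^sub>R outer x) = f (A + s *\<^sub>R outer x + t *\<^sub>R outer x)"
      by (simp add: algebra_simps)
    then show "f (A + (s + t) *\<^sub>R outer x) = f A + (coef A x s + coef A x t) *\<^sub>R outer (dir x)"
      using coef[OF x, of "A + s *\<^sub>R outer x" t] coef[OF x, of A s] coef_shift_self[OF x, of A s t]
      by (simp add: algebra_simps)
  qed
qed (simp add: coef_le_iff[OF x])

text \<open>
  The images of two comparable parallel lines remain comparable as the parameter tends to
  \<open>\<infinity>\<close> and to \<open>-\<infinity>\<close>, so their slopes agree.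
\<close>

lemma coef_const:
  assumes x: "x \<noteq> 0"
  shows "coef A x 1 = coef B x 1"
proof -
  have "coef A x 1 = coef C x 1" if "A \<le> C" for A C
  proof (rule ccontr)
    assume ne: "coef A x 1 \<noteq> coef C x 1"
    define k where "k = qf (outer (dir x)) (dir x)"
    have k: "k \<noteq> 0" using dir_nonzero[OF x] by (simp add: k_def qf_outer)
    define t where "t = (qf (f C) (dir x) - qf (f A) (dir x) + 1) / ((coef A x 1 - coef C x 1) * k)"
    have "f (A + t *\<^sub>R outer x) \<le> f (C + t *\<^sub>R outer x)"
      using that by (simp add: order)
    then have "qf (f A) (dir x) + t * coef A x 1 * k \<le> qf (f C) (dir x) + t * coef C x 1 * k"
      unfolding coef[OF x] coef_linear[OF x, of _ t] less_eq_herm_def by (simp add: k_def)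
    moreover have "t * ((coef A x 1 - coef C x 1) * k) = qf (f C) (dir x) - qf (f A) (dir x) + 1"
      using ne k by (simp add: t_def)
    ultimately show False by (simp add: algebra_simps)
  qed
  then show ?thesis by (metis herm_upper_bound)
qed

text \<open>
  This is the linearity of \<open>f - f 0\<close> on operators of finite rank, and more:
  \<open>A\<close> may be any operator.
\<close>

theorem rank_one_affine:
  obtains V where "\<And>A t x. f (A + t *\<^sub>R outer x) = f A + t *\<^sub>R outer (V x)"
proof
  define V where "V x = sqrt (coef 0 x 1) *\<^sub>R (if x = 0 then 0 else dir x)" for x
  fix A t x
  show "f (A + t *\<^sub>R outer x) = f A + t *\<^sub>R outer (V x)"
  proof (cases "x = 0")
    case False
    have "0 \<le> coef 0 x 1"
      using coef_le_iff[OF False, of 0 0 1] by (simp add: coef_zero[OF False])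
    then have "outer (V x) = coef 0 x 1 *\<^sub>R outer (dir x)"
      using False by (simp add: V_def outer_scaleR)
    then show ?thesis
      using coef_linear[OF False, of A t] coef_const[OF False, of A 0]
      by (simp add: coef[OF False])
  qed (simp add: V_def)
qed

end

section \<open>The vector map behind an order and orthogonality automorphism\<close>

lemma affine_nonneg_imp_slope_0:
  fixes a b :: real
  assumes "\<And>t. 0 \<le> a + t * b"
  shows "b = 0"
proof (rule ccontr)
  assume "b \<noteq> 0"
  with assms[of "- (a + 1) / b"] show False by simp
qed

lemma quadratic_nonneg_imp_linear_0:
  fixes b c :: real
  assumes "\<And>t. 0 \<le> t * b + t\<^sup>2 * c"
  shows "b = 0"
proof (rule ccontr)
  assume "b \<noteq> 0"
  define d where "d = \<bar>c\<bar> + 1"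
  have "0 \<le> - b / d * b + (- b / d)\<^sup>2 * c"
    by (rule assms)
  also have "\<dots> = b\<^sup>2 * (c - d) / d\<^sup>2"
    by (simp add: d_def power2_eq_square divide_simps) (simp add: algebra_simps)
  also have "\<dots> < 0"
    using \<open>b \<noteq> 0\<close> by (auto simp: d_def divide_less_0_iff mult_less_0_iff)
  finally show False by simp
qed

lemma outer_orthogonal_iff:
  "(\<forall>z. app (outer x) (app (outer y) z) = 0) \<longleftrightarrow> cinner x y = 0"
proof
  assume "\<forall>z. app (outer x) (app (outer y) z) = 0"
  then have "app (outer x) (app (outer y) y) = 0" by blast
  then show "cinner x y = 0"
    using cinner_eq_0_commute[of x y] by (auto simp: app_outer cinner_simps)
next
  assume "cinner x y = 0"
  then show "\<forall>z. app (outer x) (app (outer y) z) = 0"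
    using cinner_eq_0_commute[of x y] by (simp add: app_outer cinner_simps)
qed

text \<open>The operator \<open>|e><x| + |x><e|\<close>; unlike \<open>outer\<close>, it is real linear in \<open>x\<close>.\<close>

definition sym_outer :: "'a::complex_inner \<Rightarrow> 'a \<Rightarrow> 'a herm" where
  "sym_outer e x = outer (e + x) - outer e - outer x"

lemma qf_sym_outer: "qf (sym_outer e x) z = 2 * Re (cinner z e * cnj (cinner z x))"
  by (simp add: sym_outer_def qf_outer_add)

lemma app_sym_outer: "app (sym_outer e x) z = cinner z x *\<^sub>C e + cinner z e *\<^sub>C x"
  by (simp add: sym_outer_def app_outer cinner_simps scaleC_add_left scaleC_add_right)

lemma sym_outer_add: "sym_outer e (x + y) = sym_outer e x + sym_outer e y"
  by (intro herm_eqI) (simp add: qf_sym_outer cinner_simps algebra_simps)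

lemma sym_outer_scaleR: "sym_outer e (t *\<^sub>R x) = t *\<^sub>R sym_outer e x"
  by (intro herm_eqI) (simp add: qf_sym_outer cinner_simps algebra_simps)

text \<open>The identity or the conjugation of the complex numbers.\<close>

definition conj_or_id :: "(complex \<Rightarrow> complex) \<Rightarrow> bool" where
  "conj_or_id \<sigma> \<longleftrightarrow> \<sigma> = (\<lambda>c. c) \<or> \<sigma> = cnj"

lemma conj_or_id_simps:
  assumes "conj_or_id \<sigma>"
  shows "\<sigma> (a + b) = \<sigma> a + \<sigma> b" "\<sigma> (a * b) = \<sigma> a * \<sigma> b" "\<sigma> (inverse a) = inverse (\<sigma> a)"
    "\<sigma> (\<sigma> a) = a" "cmod (\<sigma> a) = cmod a" "Re (\<sigma> a) = Re a" "\<sigma> (of_real r) = of_real r"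
  using assms by (auto simp: conj_or_id_def)

locale order_orthogonality_automorphism = order_automorphism_dim2 +
  assumes orth: "(\<forall>z. app (f A) (app (f B) z) = 0) \<longleftrightarrow> (\<forall>z. app A (app B z) = 0)"
begin

text \<open>Zero is the only operator that is orthogonal to itself.\<close>

lemma f_zero [simp]: "f 0 = 0"
proof (rule herm_eqI)
  fix x
  have "app (f 0) (app (f 0) x) = 0"
    using orth[of 0 0] by simp
  then have "cinner (app (f 0) x) (app (f 0) x) = 0"
    by (simp add: cinner_app_left)
  then show "qf (f 0) x = qf 0 x"
    by (simp add: qf_def)
qed

context
  fixes V :: "'a \<Rightarrow> 'a"
  assumes V: "f (A + t *\<^sub>R outer x) = f A + t *\<^sub>R outer (V x)"
begin

lemma f_outer: "f (outer x) = outer (V x)"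
  using V[of 0 1 x] by simp

text \<open>Real linear relations between operators \<open>outer x\<close> carry over to the \<open>outer (V x)\<close>.\<close>

lemma V_relation:
  assumes "(\<Sum>(t, x)\<leftarrow>r. t *\<^sub>R outer x) = 0"
  shows "(\<Sum>(t, x)\<leftarrow>r. t *\<^sub>R outer (V x)) = 0"
proof -
  have "f (\<Sum>(t, x)\<leftarrow>r. t *\<^sub>R outer x) = (\<Sum>(t, x)\<leftarrow>r. t *\<^sub>R outer (V x))" for r
  proof (induction r)
    case (Cons p r)
    then show ?case
      using V[of "\<Sum>(t, x)\<leftarrow>r. t *\<^sub>R outer x" "fst p" "snd p"]
      by (cases p) (simp add: add.commute Cons)
  qed simp
  with assms show ?thesis by (metis f_zero)
qed

lemma V_orthogonal_iff: "cinner (V x) (V y) = 0 \<longleftrightarrow> cinner x y = 0"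
  using orth[of "outer x" "outer y"] by (simp add: f_outer outer_orthogonal_iff)

lemma V_eq_0_iff: "V x = 0 \<longleftrightarrow> x = 0"
  using V_orthogonal_iff[of x x] by simp

lemma outer_V_scaleC: "outer (V (c *\<^sub>C x)) = (cmod c)\<^sup>2 *\<^sub>R outer (V x)"
  using V_relation[of "[(1, c *\<^sub>C x), (- (cmod c)\<^sup>2, x)]"] by (simp add: outer_scaleC)

lemma outer_V_parallelogram:
  "outer (V (x + y)) + outer (V (x - y)) = 2 *\<^sub>R outer (V x) + 2 *\<^sub>R outer (V y)"
  using V_relation[of "[(1, x + y), (1, x - y), (-2, x), (-2, y)]"] outer_parallelogram[of x y]
  by (simp add: algebra_simps)

lemma outer_V_onto: "\<exists>x. outer (V x) = outer y"
proof -
  have "inv f 0 = 0" using inv_f(1)[of 0] by simp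
  then obtain x where "inv f (outer y) = outer x"
    using order_automorphism.image_add_outer[OF inverse, of 0 y] by auto
  then have "outer y = outer (V x)"
    by (metis f_outer inv_f(2))
  then show ?thesis by metis
qed

text \<open>
  For \<open>x\<close> orthogonal to \<open>e\<close>, the operator \<open>V_sym e x\<close> turns out to be \<open>|V e><y| + |y><V e|\<close> with a
  multiple \<open>y\<close> of \<open>V x\<close>. The vector \<open>y\<close>, which depends on \<open>x\<close> real linearly, is recovered
  by applying the operator to \<open>V e\<close>.
\<close>

definition V_sym :: "'a \<Rightarrow> 'a \<Rightarrow> 'a herm" where
  "V_sym e x = outer (V (e + x)) - outer (V e) - outer (V x)"

definition lin :: "'a \<Rightarrow> 'a \<Rightarrow> 'a" where
  "lin e x = (1 / (norm (V e))\<^sup>2) *\<^sub>R app (V_sym e x) (V e)"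

lemma V_sym_add: "V_sym e (x + y) = V_sym e x + V_sym e y"
  using V_relation[of "[(1, e + (x + y)), (1, e), (-1, x + y), (-1, e + x), (1, x), (-1, e + y), (1, y)]"]
    sym_outer_add[of e x y]
  by (simp add: V_sym_def sym_outer_def algebra_simps)

lemma V_sym_scaleR: "V_sym e (t *\<^sub>R x) = t *\<^sub>R V_sym e x"
  using V_relation[of "[(1, e + t *\<^sub>R x), (-1, e), (-1, t *\<^sub>R x), (-t, e + x), (t, e), (t, x)]"]
    sym_outer_scaleR[of e t x]
  by (simp add: V_sym_def sym_outer_def algebra_simps)

lemma lin_add: "lin e (x + y) = lin e x + lin e y"
  by (simp add: lin_def V_sym_add scaleR_add_right)

lemma lin_scaleR: "lin e (t *\<^sub>R x) = t *\<^sub>R lin e x"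
  by (simp add: lin_def V_sym_scaleR)

text \<open>
  As \<open>V e\<close> and \<open>V x\<close> are orthogonal, it suffices to show that \<open>V (e + x)\<close> is a combination of them
  with coefficients of modulus one. A phase factor then turns the coefficient of \<open>V e\<close> into one.
\<close>

lemma V_sym_orthogonal:
  assumes "e \<noteq> 0" and ex: "cinner e x = 0"
  obtains y where "cinner (V e) y = 0" "outer (V x) = outer y" "outer (V (e + x)) = outer (V e + y)"
proof (cases "x = 0")
  case True
  then show ?thesis using that[of 0] by (simp add: V_eq_0_iff)
next
  case False
  define e' x' w where "e' = V e" and "x' = V x" and "w = V (e + x)"
  have nz: "e' \<noteq> 0" "x' \<noteq> 0"
    using \<open>e \<noteq> 0\<close> False by (simp_all add: e'_def x'_def V_eq_0_iff)
  have e'x': "cinner e' x' = 0" "cinner x' e' = 0"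
    using ex cinner_eq_0_commute[of e' x'] by (simp_all add: e'_def x'_def V_orthogonal_iff)
  obtain a u where a: "w = a *\<^sub>C e' + u" "cinner e' u = 0"
    by (rule orthogonal_decomposition)
  obtain b z where b: "u = b *\<^sub>C x' + z" "cinner x' z = 0"
    by (rule orthogonal_decomposition)
  have "cinner e' z = 0"
    using a(2) e'x' by (simp add: b cinner_simps)
  then have z: "cinner z e' = 0" "cinner z x' = 0"
    using b(2) cinner_eq_0_commute by blast+
  \<comment> \<open>The parallelogram law confines \<open>w\<close> to the span of \<open>e'\<close> and \<open>x'\<close>.\<close>
  have "qf (outer w + outer (V (e - x))) z = qf (2 *\<^sub>R outer e' + 2 *\<^sub>R outer x') z"
    unfolding e'_def x'_def w_def by (simp only: outer_V_parallelogram)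
  then have "(cmod (cinner z w))\<^sup>2 + (cmod (cinner z (V (e - x))))\<^sup>2 = 0"
    by (simp add: qf_outer z)
  then have "cinner z w = 0"
    by (simp add: add_nonneg_eq_0_iff)
  then have "z = 0"
    by (simp add: a b cinner_simps z)
  then have w: "w = a *\<^sub>C e' + b *\<^sub>C x'"
    by (simp add: a b)
  \<comment> \<open>The form of \<open>outer (V (e + t *\<^sub>R x))\<close> is nonnegative for all \<open>t\<close>; at \<open>e'\<close> and at \<open>x'\<close> this forces
    the linear term in \<open>t\<close> to vanish.\<close>
  have nonneg: "0 \<le> qf (outer e') v + t * qf (V_sym e x) v + t\<^sup>2 * qf (outer x') v" for t v
  proof -
    have "outer (V (e + t *\<^sub>R x)) = outer e' + t *\<^sub>R V_sym e x + t\<^sup>2 *\<^sub>R outer x'"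
      using V_sym_scaleR[of e t x] outer_V_scaleC[of "of_real t" x]
      by (simp add: V_sym_def e'_def x'_def algebra_simps flip: scaleR_eq_scaleC)
    then have "qf (outer (V (e + t *\<^sub>R x))) v
        = qf (outer e') v + t * qf (V_sym e x) v + t\<^sup>2 * qf (outer x') v"
      by simp
    then show ?thesis by (metis qf_outer zero_le_power2)
  qed
  have "qf (V_sym e x) e' = 0"
    using nonneg[where v = e'] e'x'
    by (intro affine_nonneg_imp_slope_0[of "qf (outer e') e'"]) (simp add: qf_outer[of x'])
  then have "(cmod a)\<^sup>2 * (norm e')^4 = (norm e')^4"
    using e'x' by (simp add: V_sym_def qf_outer w cinner_simps cinner_self norm_mult norm_power
        power_mult_distrib flip: w_def e'_def x'_def power_mult)
  then have a1: "(cmod a)\<^sup>2 = 1" using nz by simp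
  have "qf (V_sym e x) x' = 0"
    using nonneg[where v = x'] e'x'
    by (intro quadratic_nonneg_imp_linear_0[of _ "qf (outer x') x'"]) (simp add: qf_outer[of e'])
  then have "(cmod b)\<^sup>2 * (norm x')^4 = (norm x')^4"
    using e'x' by (simp add: V_sym_def qf_outer w cinner_simps cinner_self norm_mult norm_power
        power_mult_distrib flip: w_def e'_def x'_def power_mult)
  then have b1: "(cmod b)\<^sup>2 = 1" using nz by simp
  define y where "y = (cnj a * b) *\<^sub>C x'"
  have aa: "cnj a * a = 1"
    using a1 complex_norm_square[of a] by (simp add: mult.commute)
  have "cnj a *\<^sub>C w = e' + y"
    by (simp add: w y_def scaleC_add_right scaleC_scaleC aa)
  then have "outer (e' + y) = outer w"
    using outer_scaleC[of "cnj a" w] a1 by simp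
  moreover have "outer x' = outer y"
    by (simp add: y_def outer_scaleC norm_mult power_mult_distrib a1 b1)
  moreover have "cinner e' y = 0"
    by (simp add: y_def cinner_simps e'x')
  ultimately show ?thesis
    using that by (simp add: e'_def x'_def w_def)
qed

lemma lin_orthogonal:
  assumes "e \<noteq> 0" "cinner e x = 0"
  shows "outer (lin e x) = outer (V x)" "outer (V e + lin e x) = outer (V (e + x))"
proof -
  obtain y where y: "cinner (V e) y = 0" "outer (V x) = outer y" "outer (V (e + x)) = outer (V e + y)"
    by (rule V_sym_orthogonal[OF assms])
  have "V_sym e x = sym_outer (V e) y"
    by (simp add: V_sym_def sym_outer_def y)
  then have "app (V_sym e x) (V e) = (norm (V e))\<^sup>2 *\<^sub>R y"
    by (simp add: app_sym_outer y cinner_self scaleR_eq_scaleC)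
  then have "lin e x = y"
    using assms(1) by (simp add: lin_def V_eq_0_iff)
  then show "outer (lin e x) = outer (V x)" "outer (V e + lin e x) = outer (V (e + x))"
    using y by simp_all
qed

text \<open>
  The factor \<open>w\<close> between \<open>lin e x\<close> and \<open>lin e (\<i> *\<^sub>C x)\<close> has modulus one, and the one between
  \<open>lin e x\<close> and \<open>lin e ((1 + \<i>) *\<^sub>C x)\<close>, namely \<open>1 + w\<close>, has the modulus of \<open>1 + \<i>\<close>.
\<close>

lemma lin_imaginary_unit:
  assumes e: "e \<noteq> 0" and x: "cinner e x = 0"
  shows "lin e (\<i> *\<^sub>C x) = \<i> *\<^sub>C lin e x \<or> lin e (\<i> *\<^sub>C x) = (- \<i>) *\<^sub>C lin e x"
proof (cases "lin e x = 0")
  case True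
  have "outer (lin e (\<i> *\<^sub>C x)) = outer (lin e x)"
    using lin_orthogonal(1)[OF e, of x] lin_orthogonal(1)[OF e, of "\<i> *\<^sub>C x"] x
    by (simp add: cinner_simps outer_V_scaleC)
  with True show ?thesis by simp
next
  case False
  then have pos: "outer (lin e x) \<noteq> 0" by simp
  have ix: "outer (lin e (\<i> *\<^sub>C x)) = 1 *\<^sub>R outer (lin e x)"
    using lin_orthogonal(1)[OF e, of x] lin_orthogonal(1)[OF e, of "\<i> *\<^sub>C x"] x
    by (simp add: cinner_simps outer_V_scaleC)
  then obtain w where w: "lin e (\<i> *\<^sub>C x) = w *\<^sub>C lin e x"
    by (rule outer_parallel)
  have 1: "(cmod w)\<^sup>2 = 1"
    using ix pos unfolding w outer_scaleC by (simp only: scaleR_cancel_right simp_thms)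
  have "(1 + w) *\<^sub>C lin e x = lin e ((1 + \<i>) *\<^sub>C x)"
    by (simp only: scaleC_add_left scaleC_one lin_add w)
  then have "outer ((1 + w) *\<^sub>C lin e x) = outer (V ((1 + \<i>) *\<^sub>C x))"
    using lin_orthogonal(1)[OF e, of "(1 + \<i>) *\<^sub>C x"] x by (simp only: cinner_simps mult_zero_right)
  also have "\<dots> = (cmod (1 + \<i>))\<^sup>2 *\<^sub>R outer (lin e x)"
    using lin_orthogonal(1)[OF e x] by (simp add: outer_V_scaleC)
  finally have 2: "(cmod (1 + w))\<^sup>2 = (cmod (1 + \<i>))\<^sup>2"
    using pos unfolding outer_scaleC by (simp only: scaleR_cancel_right simp_thms)
  have "Re w = 0"
    using 1 2 unfolding cmod_power2 by (simp add: power2_eq_square algebra_simps)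
  moreover from this have "Im w = 1 \<or> Im w = -1"
    using 1 unfolding cmod_power2 by (simp add: power2_eq_1_iff)
  ultimately have "w = \<i> \<or> w = - \<i>"
    by (auto simp: complex_eq_iff)
  then show ?thesis using w by auto
qed

text \<open>
  The sign is the same for all vectors: if it differed for \<open>p\<close> and \<open>q\<close>, there would be none
  for \<open>p + q\<close>.
\<close>

lemma lin_scaleC:
  assumes e: "e \<noteq> 0"
  obtains \<sigma> where "conj_or_id \<sigma>" "\<And>c x. cinner e x = 0 \<Longrightarrow> lin e (c *\<^sub>C x) = \<sigma> c *\<^sub>C lin e x"
proof -
  have double: "u = 0" if "\<i> *\<^sub>C u = (- \<i>) *\<^sub>C u" for u :: 'a
  proof -
    have "(\<i> - (- \<i>)) *\<^sub>C u = 0"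
      by (simp only: complex_vector.scale_left_diff_distrib that diff_self)
    then show ?thesis
      unfolding scaleC_eq_0_iff by (simp add: complex_eq_iff)
  qed
  have "(\<forall>x. cinner e x = 0 \<longrightarrow> lin e (\<i> *\<^sub>C x) = \<i> *\<^sub>C lin e x) \<or>
        (\<forall>x. cinner e x = 0 \<longrightarrow> lin e (\<i> *\<^sub>C x) = (- \<i>) *\<^sub>C lin e x)"
  proof (rule ccontr)
    assume "\<not> ?thesis"
    then obtain p q where p: "cinner e p = 0" "lin e (\<i> *\<^sub>C p) \<noteq> \<i> *\<^sub>C lin e p"
      and q: "cinner e q = 0" "lin e (\<i> *\<^sub>C q) \<noteq> (- \<i>) *\<^sub>C lin e q"
      by blast
    have p': "lin e (\<i> *\<^sub>C p) = (- \<i>) *\<^sub>C lin e p" and q': "lin e (\<i> *\<^sub>C q) = \<i> *\<^sub>C lin e q"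
      using lin_imaginary_unit[OF e] p q by blast+
    have "cinner e (p + q) = 0"
      using p(1) q(1) by (simp add: cinner_simps)
    from lin_imaginary_unit[OF e this]
    have "(- \<i>) *\<^sub>C lin e p = \<i> *\<^sub>C lin e p \<or> \<i> *\<^sub>C lin e q = (- \<i>) *\<^sub>C lin e q"
      unfolding scaleC_add_right lin_add p' q' by (metis add_left_cancel add_right_cancel)
    then have "lin e p = 0 \<or> lin e q = 0"
      using double by metis
    then show False
      using p q p' q' by auto
  qed
  then obtain \<sigma> where \<sigma>: "conj_or_id \<sigma>"
    "\<And>x. cinner e x = 0 \<Longrightarrow> lin e (\<i> *\<^sub>C x) = \<sigma> \<i> *\<^sub>C lin e x"
    unfolding conj_or_id_def by (metis complex_cnj_i)
  have "lin e (c *\<^sub>C x) = \<sigma> c *\<^sub>C lin e x" if "cinner e x = 0" for c x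
  proof -
    have c: "c = of_real (Re c) + of_real (Im c) * \<i>"
      by (simp add: complex_eq_iff)
    have "c *\<^sub>C x = Re c *\<^sub>R x + Im c *\<^sub>R \<i> *\<^sub>C x"
      by (subst c) (simp only: scaleC_add_left scaleR_eq_scaleC scaleC_scaleC)
    then have "lin e (c *\<^sub>C x) = Re c *\<^sub>R lin e x + Im c *\<^sub>R \<sigma> \<i> *\<^sub>C lin e x"
      by (simp add: lin_add lin_scaleR \<sigma>(2) that)
    also have "\<dots> = \<sigma> c *\<^sub>C lin e x"
      by (subst (3) c)
        (simp only: conj_or_id_simps[OF \<sigma>(1)] scaleC_add_left scaleR_eq_scaleC scaleC_scaleC)
    finally show ?thesis .
  qed
  with \<sigma>(1) show ?thesis by (rule that)
qed

text \<open>
  The semilinear map is \<open>lin e\<close> on the orthogonal complement of \<open>e\<close> and sends \<open>e\<close> to \<open>V e\<close>.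
  A vector that is not in the complement has a multiple of the form \<open>e + y\<close> with \<open>y\<close> in the
  complement.
\<close>

lemma semilinear_representative:
  "\<exists>T \<sigma>. conj_or_id \<sigma> \<and> (\<forall>x y. T (x + y) = T x + T y) \<and>
    (\<forall>c x. T (c *\<^sub>C x) = \<sigma> c *\<^sub>C T x) \<and> (\<forall>x. outer (T x) = outer (V x))"
proof -
  obtain e :: 'a where e: "e \<noteq> 0"
    using dim[of 0] by (metis complex_vector.scale_zero_right)
  obtain \<sigma> where \<sigma>: "conj_or_id \<sigma>"
    and lin_scaleC: "\<And>c x. cinner e x = 0 \<Longrightarrow> lin e (c *\<^sub>C x) = \<sigma> c *\<^sub>C lin e x"
    using lin_scaleC[OF e] by blast
  note \<sigma>_simps = conj_or_id_simps[OF \<sigma>]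
  define p where "p x = cinner x e / cinner e e" for x
  define q where "q x = x - p x *\<^sub>C e" for x
  define T where "T x = lin e (q x) + \<sigma> (p x) *\<^sub>C V e" for x
  have p: "p (x + y) = p x + p y" "p (c *\<^sub>C x) = c * p x" for x y c
    by (simp_all add: p_def cinner_simps add_divide_distrib)
  have q: "q (x + y) = q x + q y" "q (c *\<^sub>C x) = c *\<^sub>C q x" for x y c
    by (simp_all add: q_def p scaleC_add_left scaleC_scaleC complex_vector.scale_right_diff_distrib)
  have eq: "cinner e (q x) = 0" for x
    using e cinner_eq_0_commute[of e "q x"] by (simp add: q_def p_def cinner_simps)
  have "T (x + y) = T x + T y" for x y
    by (simp add: T_def p q lin_add \<sigma>_simps scaleC_add_left)
  moreover have "T (c *\<^sub>C x) = \<sigma> c *\<^sub>C T x" for c x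
    by (simp add: T_def p q lin_scaleC eq \<sigma>_simps scaleC_add_right scaleC_scaleC)
  moreover have "outer (T x) = outer (V x)" for x
  proof (cases "p x = 0")
    case True
    then have "T x = lin e x"
      using \<sigma>_simps(7)[of 0] by (simp add: T_def q_def)
    then show ?thesis
      using lin_orthogonal(1)[OF e, of x] eq[of x] True by (simp add: q_def)
  next
    case False
    define a y where "a = p x" and "y = inverse a *\<^sub>C q x"
    have a: "a \<noteq> 0" using False by (simp add: a_def)
    have x: "x = a *\<^sub>C (e + y)"
      using a by (simp add: y_def scaleC_add_right scaleC_scaleC) (simp add: q_def a_def)
    have "lin e y = inverse (\<sigma> a) *\<^sub>C lin e (q x)"
      by (simp only: y_def lin_scaleC[OF eq] \<sigma>_simps)
    moreover have "\<sigma> a \<noteq> 0"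
      using a \<sigma>_simps(5)[of a] by auto
    ultimately have "T x = \<sigma> a *\<^sub>C (V e + lin e y)"
      by (simp add: T_def scaleC_add_right scaleC_scaleC flip: a_def)
    then have "outer (T x) = (cmod a)\<^sup>2 *\<^sub>R outer (V (e + y))"
      using lin_orthogonal(2)[OF e, of y] eq by (simp add: outer_scaleC \<sigma>_simps y_def cinner_simps)
    then show ?thesis
      by (simp add: x outer_V_scaleC)
  qed
  ultimately show ?thesis using \<sigma> by blast
qed

end

text \<open>
  A semilinear map that preserves orthogonality is a multiple of an isometry: apply it to the
  orthogonal vectors \<open>p + q\<close> and \<open>p - q\<close> where \<open>p\<close> and \<open>q\<close> are orthogonal and of equal length.
\<close>

lemma semilinear_orthogonality_preserving:
  fixes T :: "'a \<Rightarrow> 'a"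
  assumes \<sigma>: "conj_or_id \<sigma>" and add: "\<And>x y. T (x + y) = T x + T y"
    and scale: "\<And>c x. T (c *\<^sub>C x) = \<sigma> c *\<^sub>C T x"
    and orth: "\<And>x y. cinner x y = 0 \<Longrightarrow> cinner (T x) (T y) = 0" and inj: "\<And>x. x \<noteq> 0 \<Longrightarrow> T x \<noteq> 0"
  shows "\<exists>l>0. \<forall>x y. cinner (T x) (T y) = of_real l * \<sigma> (cinner x y)"
proof -
  note \<sigma>_simps = conj_or_id_simps[OF \<sigma>]
  have scaleR: "T (r *\<^sub>R x) = r *\<^sub>R T x" for r x
    by (simp add: scaleR_eq_scaleC scale \<sigma>_simps)
  have diff: "T (x - y) = T x - T y" for x y
    using add[of "x - y" y] by simp
  have pythagoras: "(norm (x + y))\<^sup>2 = (norm x)\<^sup>2 + (norm y)\<^sup>2" if "cinner x y = 0" for x y :: 'a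
  proof -
    have "complex_of_real ((norm (x + y))\<^sup>2) = of_real ((norm x)\<^sup>2 + (norm y)\<^sup>2)"
      using that cinner_eq_0_commute[of x y]
      unfolding of_real_add cinner_self[symmetric] by (simp add: cinner_simps)
    then show ?thesis using of_real_eq_iff by blast
  qed
  have equal: "norm (T p) = norm (T q)" if "cinner p q = 0" "norm p = norm q" for p q
  proof -
    have qp: "cinner q p = 0" using that cinner_eq_0_commute by blast
    have "cinner (p + q) (p - q) = 0"
      using that qp by (simp add: cinner_simps cinner_self)
    then have "cinner (T p + T q) (T p - T q) = 0"
      using orth[of "p + q" "p - q"] by (simp add: add diff)
    then have "cinner (T p) (T p) = cinner (T q) (T q)"
      using orth[OF that(1)] orth[OF qp] by (simp add: cinner_simps)
    then have "complex_of_real ((norm (T p))\<^sup>2) = of_real ((norm (T q))\<^sup>2)"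
      by (simp only: cinner_self)
    then show ?thesis
      using of_real_eq_iff by (metis norm_ge_zero power2_eq_iff_nonneg)
  qed
  obtain e :: 'a where e: "e \<noteq> 0"
    using dim[of 0] by (metis complex_vector.scale_zero_right)
  define k where "k = norm (T e) / norm e"
  have k: "k > 0" using e inj[OF e] by (simp add: k_def)
  have ortho: "norm (T z) = k * norm z" if "cinner e z = 0" for z
  proof (cases "z = 0")
    case True
    then show ?thesis using scaleR[of 0 0] by simp
  next
    case False
    have "norm (T e) = norm (T ((norm e / norm z) *\<^sub>R z))"
      using that False by (intro equal) (simp_all add: cinner_simps)
    then show ?thesis
      using e False by (simp add: scaleR k_def field_simps)
  qed
  have norm_T: "(norm (T x))\<^sup>2 = k\<^sup>2 * (norm x)\<^sup>2" for x
  proof -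
    obtain c z where x: "x = c *\<^sub>C e + z" and z: "cinner e z = 0"
      by (rule orthogonal_decomposition)
    have "(norm (T x))\<^sup>2 = (norm (\<sigma> c *\<^sub>C T e))\<^sup>2 + (norm (T z))\<^sup>2"
      unfolding x add scale using orth[OF z] by (intro pythagoras) (simp add: cinner_simps)
    also have "\<dots> = k\<^sup>2 * ((norm (c *\<^sub>C e))\<^sup>2 + (norm z)\<^sup>2)"
      using e by (simp add: norm_scaleC \<sigma>_simps ortho[OF z] k_def field_simps)
    also have "(norm (c *\<^sub>C e))\<^sup>2 + (norm z)\<^sup>2 = (norm x)\<^sup>2"
      unfolding x using z by (intro pythagoras[symmetric]) (simp add: cinner_simps)
    finally show ?thesis .
  qed
  have "cinner (T x) (T y) = of_real (k\<^sup>2) * \<sigma> (cinner x y)" for x y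
  proof -
    obtain c z where x: "x = c *\<^sub>C y + z" and z: "cinner y z = 0"
      by (rule orthogonal_decomposition)
    have zy: "cinner z y = 0" using z cinner_eq_0_commute by blast
    have "cinner (T x) (T y) = \<sigma> c * of_real ((norm (T y))\<^sup>2)"
      unfolding x add scale using orth[OF zy] by (simp only: cinner_simps cinner_self add_0_right)
    also have "\<dots> = of_real (k\<^sup>2) * \<sigma> (c * of_real ((norm y)\<^sup>2))"
      unfolding norm_T \<sigma>_simps by (simp only: of_real_mult mult.commute mult.left_commute)
    also have "c * of_real ((norm y)\<^sup>2) = cinner x y"
      unfolding x using zy by (simp only: cinner_simps cinner_self add_0_right)
    finally show ?thesis .
  qed
  with k show ?thesis by (intro exI[of _ "k\<^sup>2"]) auto
qed

theorem semilinear_implementation: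
  "\<exists>T \<sigma> l. conj_or_id \<sigma> \<and> l > 0 \<and> (\<forall>x y. T (x + y) = T x + T y) \<and>
    (\<forall>c x. T (c *\<^sub>C x) = \<sigma> c *\<^sub>C T x) \<and> surj T \<and>
    (\<forall>x y. cinner (T x) (T y) = of_real l * \<sigma> (cinner x y)) \<and>
    (\<forall>A t x. f (A + t *\<^sub>R outer x) = f A + t *\<^sub>R outer (T x))"
proof -
  obtain V where V: "\<And>A t x. f (A + t *\<^sub>R outer x) = f A + t *\<^sub>R outer (V x)"
    using rank_one_affine by blast
  obtain T \<sigma> where \<sigma>: "conj_or_id \<sigma>" and add: "\<And>x y. T (x + y) = T x + T y"
    and scale: "\<And>c x. T (c *\<^sub>C x) = \<sigma> c *\<^sub>C T x" and TV: "\<And>x. outer (T x) = outer (V x)"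
    using semilinear_representative[of V, OF V] by metis
  have T: "f (A + t *\<^sub>R outer x) = f A + t *\<^sub>R outer (T x)" for A t x
    by (simp add: V TV)
  have "\<exists>l>0. \<forall>x y. cinner (T x) (T y) = of_real l * \<sigma> (cinner x y)"
  proof (rule semilinear_orthogonality_preserving[OF \<sigma> add scale])
    show "cinner (T x) (T y) = 0" if "cinner x y = 0" for x y
      using that V_orthogonal_iff[of T, OF T] by blast
    show "T x \<noteq> 0" if "x \<noteq> 0" for x
      using that V_eq_0_iff[of T, OF T] by blast
  qed
  then obtain l where l: "l > 0" "\<And>x y. cinner (T x) (T y) = of_real l * \<sigma> (cinner x y)"
    by blast
  have "\<exists>x. y = T x" for y
  proof -
    obtain x where "outer y = 1 *\<^sub>R outer (T x)"
      using outer_V_onto[of T, OF T, of y] by (metis scaleR_one)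
    then obtain c where "y = c *\<^sub>C T x" by (rule outer_parallel)
    then have "y = T (\<sigma> c *\<^sub>C x)"
      by (simp add: scale conj_or_id_simps[OF \<sigma>])
    then show ?thesis by blast
  qed
  then have "surj T" by (auto simp: surj_def)
  show ?thesis
    by (intro exI[of _ T] exI[of _ \<sigma>] exI[of _ l] conjI allI)
      (fact \<sigma> l add scale \<open>surj T\<close> T)+
qed

end

section \<open>From rank one operators to all operators\<close>

context order_orthogonality_automorphism
begin

text \<open>
  Once \<open>f\<close> is known along rank one operators, it is known: for \<open>A \<ge> B\<close> the largest multiple of
  \<open>outer ((A - B) x)\<close> below \<open>A - B\<close> gives a lower bound for \<open>f A - f B\<close> that is exact at \<open>T x\<close>,
  and the same argument for \<open>inv f\<close> gives the opposite inequality.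
\<close>

lemma qf_image:
  fixes T :: "'a \<Rightarrow> 'a"
  assumes \<sigma>: "conj_or_id \<sigma>" and l: "l > 0" and T: "surj T"
    "\<And>x y. cinner (T x) (T y) = of_real l * \<sigma> (cinner x y)"
    and f: "\<And>A t x. f (A + t *\<^sub>R outer x) = f A + t *\<^sub>R outer (T x)"
  shows "qf (f A) (T x) = l\<^sup>2 * qf A x"
proof -
  note \<sigma>_simps = conj_or_id_simps[OF \<sigma>]
  have outer_T: "qf (outer (T y)) (T x) = l\<^sup>2 * qf (outer y) x" for x y
    using l by (simp add: qf_outer T(2) norm_mult \<sigma>_simps power_mult_distrib)
  have diff: "qf (f A - f B) (T x) = l\<^sup>2 * qf (A - B) x" if "B \<le> A" for A B x
  proof (rule antisym)
    define D E where "D = A - B" and "E = f A - f B"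
    have D: "0 \<le> D" and E: "0 \<le> E"
      using that order by (simp_all add: D_def E_def)
    then have qD: "0 \<le> qf D x" and qE: "0 \<le> qf E (T x)"
      by (simp_all add: less_eq_herm_def)
    show "l\<^sup>2 * qf (A - B) x \<le> qf (f A - f B) (T x)"
    proof (cases "qf D x = 0")
      case True
      then show ?thesis using qE by (simp add: D_def E_def)
    next
      case False
      with qD have pos: "0 < qf D x" by simp
      from outer_le_nonneg[OF D pos] have "B + (1 / qf D x) *\<^sub>R outer (app D x) \<le> A"
        by (simp add: D_def algebra_simps)
      then have "f B + (1 / qf D x) *\<^sub>R outer (T (app D x)) \<le> f A"
        by (simp only: order flip: f)
      then have "qf (f B + (1 / qf D x) *\<^sub>R outer (T (app D x))) (T x) \<le> qf (f A) (T x)"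
        by (simp only: less_eq_herm_def)
      then have "qf (f B) (T x) + (1 / qf D x) * (l\<^sup>2 * (qf D x)\<^sup>2) \<le> qf (f A) (T x)"
        by (simp only: qf_simps outer_T qf_outer_app)
      moreover have "(1 / qf D x) * (l\<^sup>2 * (qf D x)\<^sup>2) = l\<^sup>2 * qf D x"
        using pos by (simp add: power2_eq_square)
      ultimately show ?thesis
        by (simp add: D_def)
    qed
    show "qf (f A - f B) (T x) \<le> l\<^sup>2 * qf (A - B) x"
    proof (cases "qf E (T x) = 0")
      case True
      then show ?thesis using qD l by (simp add: D_def E_def)
    next
      case False
      with qE have pos: "0 < qf E (T x)" by simp
      obtain w where w: "app E (T x) = T w"
        using T(1) by (metis surjD)
      from outer_le_nonneg[OF E pos] have "f B + (1 / qf E (T x)) *\<^sub>R outer (T w) \<le> f B + E"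
        unfolding w by (rule add_left_mono)
      then have "f B + (1 / qf E (T x)) *\<^sub>R outer (T w) \<le> f A"
        by (simp add: E_def)
      then have "B + (1 / qf E (T x)) *\<^sub>R outer w \<le> A"
        by (simp only: order flip: f)
      then have "qf (B + (1 / qf E (T x)) *\<^sub>R outer w) x \<le> qf A x"
        by (simp only: less_eq_herm_def)
      then have "(1 / qf E (T x)) * (l\<^sup>2 * qf (outer w) x) \<le> l\<^sup>2 * qf D x"
        using mult_left_mono[of "(1 / qf E (T x)) * qf (outer w) x" "qf D x" "l\<^sup>2"]
        by (simp add: D_def mult.left_commute)
      also have "l\<^sup>2 * qf (outer w) x = (qf E (T x))\<^sup>2"
        using qf_outer_app[of E "T x"] by (simp add: w outer_T)
      finally show ?thesis
        using pos by (simp add: D_def E_def power2_eq_square)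
    qed
  qed
  obtain C where C: "A \<le> C" "0 \<le> C"
    by (rule herm_upper_bound)
  show ?thesis
    using diff[OF C(1), of x] diff[OF C(2), of x] by (simp add: algebra_simps)
qed

text \<open>
  Polarization of the preceding identity, with \<open>T\<close> divided by \<open>sqrt l\<close> to make it isometric.
\<close>

theorem implementation:
  "\<exists>U \<sigma> l. conj_or_id \<sigma> \<and> l > 0 \<and> (\<forall>x y. U (x + y) = U x + U y) \<and>
    (\<forall>c x. U (c *\<^sub>C x) = \<sigma> c *\<^sub>C U x) \<and> surj U \<and>
    (\<forall>x y. cinner (U x) (U y) = \<sigma> (cinner x y)) \<and>
    (\<forall>A x. app (f A) (U x) = l *\<^sub>R U (app A x))"
proof -
  obtain T \<sigma> l where \<sigma>: "conj_or_id \<sigma>" and l: "l > 0"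
    and add: "\<And>x y. T (x + y) = T x + T y" and scale: "\<And>c x. T (c *\<^sub>C x) = \<sigma> c *\<^sub>C T x"
    and "surj T" and inner: "\<And>x y. cinner (T x) (T y) = of_real l * \<sigma> (cinner x y)"
    and f: "\<And>A t x. f (A + t *\<^sub>R outer x) = f A + t *\<^sub>R outer (T x)"
    using semilinear_implementation by blast
  note \<sigma>_simps = conj_or_id_simps[OF \<sigma>]
  have scaleR: "T (r *\<^sub>R x) = r *\<^sub>R T x" for r x
    by (simp add: scaleR_eq_scaleC scale \<sigma>_simps)
  define U where "U x = (1 / sqrt l) *\<^sub>R T x" for x
  have TU: "T x = sqrt l *\<^sub>R U x" for x
    using l by (simp add: U_def)
  have U_add: "U (x + y) = U x + U y" for x y
    by (simp add: U_def add scaleR_add_right)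
  have U_scale: "U (c *\<^sub>C x) = \<sigma> c *\<^sub>C U x" for c x
    by (simp add: U_def scale scaleC_scaleR_commute)
  have "\<exists>x. y = U x" for y
  proof -
    obtain x where "sqrt l *\<^sub>R y = T x" using \<open>surj T\<close> by (metis surjD)
    then have "y = U x" using l by (simp add: U_def flip: \<open>sqrt l *\<^sub>R y = T x\<close>)
    then show ?thesis by blast
  qed
  then have U_surj: "surj U" by (auto simp: surj_def)
  have U_inner: "cinner (U x) (U y) = \<sigma> (cinner x y)" for x y
  proof -
    have "complex_of_real (sqrt l) * of_real (sqrt l) = of_real l"
      using l by (simp flip: of_real_mult)
    then show ?thesis
      using l by (simp add: U_def cinner_simps inner)
  qed
  have qU: "qf (f A) (U x) = l * qf A x" for A x
  proof -
    have "qf (f A) (T x) = l * qf (f A) (U x)"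
      using l qf_scaleC[of "f A" "of_real (sqrt l)" "U x"] by (simp add: TU scaleR_eq_scaleC)
    then show ?thesis
      using qf_image[OF \<sigma> l \<open>surj T\<close> inner f, of A x] l by (simp add: power2_eq_square)
  qed
  have app_U: "app (f A) (U x) = l *\<^sub>R U (app A x)" for A x
  proof -
    define d where "d = app (f A) (U x) - l *\<^sub>R U (app A x)"
    obtain y where y: "d = U y" using U_surj by (metis surjD)
    have "Re (cinner (app (f A) (U x)) (U y)) = l * Re (cinner (app A x) y)"
      using qf_add_right[of "f A" "U x" "U y"] qf_add_right[of A x y]
      by (simp add: qU algebra_simps flip: U_add)
    then have "Re (cinner d (U y)) = 0"
      by (simp add: d_def cinner_simps U_inner \<sigma>_simps)
    then show ?thesis
      by (simp add: cinner_self d_def flip: y)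
  qed
  show ?thesis
    by (intro exI[of _ U] exI[of _ \<sigma>] exI[of _ l] conjI allI)
      (fact \<sigma> l U_add U_scale U_surj U_inner app_U)+
qed

end

section \<open>Automorphisms as maps of operators\<close>

lemma two_dimensional:
  assumes "1 < cdim TYPE('a::complex_inner)"
  shows "\<exists>y. \<forall>c. y \<noteq> c *\<^sub>C (x::'a)"
proof (rule ccontr)
  assume "\<not> ?thesis"
  then have "complex_vector.span {x} = UNIV"
    by (auto simp: complex_vector.span_singleton)
  moreover from this have "complex_vector.dim (UNIV :: 'a set) \<le> card {x}"
    by (intro complex_vector.dim_le_card) auto
  ultimately have "cdim TYPE('a) \<le> 1"
    by (auto simp: cdim_def one_enat_def)
  with assms show False by simp
qed

theorem corollary5:
  fixes \<phi> :: "('a::complex_hilbert_space \<Rightarrow> 'a) \<Rightarrow> ('a \<Rightarrow> 'a)"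
  assumes dim: "1 < cdim TYPE('a)"
    and bij: "bij_betw \<phi> selfadjoint_ops selfadjoint_ops"
    and order: "\<And>A B. A \<in> selfadjoint_ops \<Longrightarrow> B \<in> selfadjoint_ops \<Longrightarrow>
                  op_le A B \<longleftrightarrow> op_le (\<phi> A) (\<phi> B)"
    and orth: "\<And>A B. A \<in> selfadjoint_ops \<Longrightarrow> B \<in> selfadjoint_ops \<Longrightarrow>
                  op_orthogonal A B \<longleftrightarrow> op_orthogonal (\<phi> A) (\<phi> B)"
  shows "\<exists>(U :: 'a \<Rightarrow> 'a) (l :: real). l > 0 \<and>
           ((unitary_op U \<and>
               (\<forall>A\<in>selfadjoint_ops. \<phi> A = (\<lambda>x. l *\<^sub>R U (A (cadjoint U x))))) \<or>
            (antiunitary_op U \<and>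
               (\<forall>A\<in>selfadjoint_ops. \<phi> A = (\<lambda>x. l *\<^sub>R U (A (conj_adjoint U x))))))"
proof -
  define f :: "'a herm \<Rightarrow> 'a herm" where "f A = Herm (\<phi> (app A))" for A
  have app_f: "app (f A) = \<phi> (app A)" for A
    using bij app[of A] by (simp add: f_def Herm_inverse bij_betw_apply)
  have bij_app: "bij_betw app UNIV selfadjoint_ops"
    by (intro bij_betwI[where g = Herm]) (auto simp: app app_inverse Herm_inverse)
  have "bij_betw (app \<circ> f) UNIV selfadjoint_ops"
    using bij_betw_trans[OF bij_app bij] by (simp add: comp_def app_f)
  then have "bij f"
    using bij_betw_comp_iff2[OF bij_app, of f UNIV] by simp
  interpret order_orthogonality_automorphism f
  proof
    show "bij f" by fact
    show "f A \<le> f B \<longleftrightarrow> A \<le> B" for A B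
      using order[OF app app, of A B] by (simp add: op_le_def less_eq_herm_def qf_def app_f)
    show "\<exists>y. \<forall>c. y \<noteq> c *\<^sub>C x" for x :: 'a
      using dim by (rule two_dimensional)
    show "(\<forall>z. app (f A) (app (f B) z) = 0) \<longleftrightarrow> (\<forall>z. app A (app B z) = 0)" for A B
      using orth[OF app app, of A B] by (simp add: op_orthogonal_def fun_eq_iff app_f)
  qed
  obtain U \<sigma> l where \<sigma>: "conj_or_id \<sigma>" and l: "l > 0"
    and add: "\<And>x y. U (x + y) = U x + U y" and scale: "\<And>c x. U (c *\<^sub>C x) = \<sigma> c *\<^sub>C U x"
    and "surj U" and inner: "\<And>x y. cinner (U x) (U y) = \<sigma> (cinner x y)"
    and fU: "\<And>A x. app (f A) (U x) = l *\<^sub>R U (app A x)"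
    using implementation by blast
  have norm: "norm (U x) = norm x" for x
  proof -
    have "complex_of_real ((norm (U x))\<^sup>2) = of_real ((norm x)\<^sup>2)"
      unfolding cinner_self[symmetric] inner
      by (simp only: cinner_self conj_or_id_simps[OF \<sigma>])
    then show ?thesis
      using of_real_eq_iff by (metis norm_ge_zero power2_eq_iff_nonneg)
  qed
  have "inj U"
  proof (rule injI)
    fix x y assume "U x = U y"
    then have "U (x - y) = 0" using add[of "x - y" y] by simp
    then show "x = y" using norm[of "x - y"] by simp
  qed
  then have "bij U" using \<open>surj U\<close> by (simp add: bij_def)
  note U_inv = surj_f_inv_f[OF \<open>surj U\<close>]
  have \<phi>: "\<phi> A = (\<lambda>x. l *\<^sub>R U (A (inv U x)))" if "A \<in> selfadjoint_ops" for A
  proof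
    fix x
    have "app (Herm A) = A" using that by (rule Herm_inverse)
    then show "\<phi> A x = l *\<^sub>R U (A (inv U x))"
      using fU[of "Herm A" "inv U x"] by (simp add: app_f U_inv)
  qed
  show ?thesis
  proof (cases "\<sigma> = (\<lambda>c. c)")
    case True
    have "is_cadjoint U (inv U)"
      unfolding is_cadjoint_def using inner[of _ "inv U _"] True by (simp add: U_inv)
    then have adj: "cadjoint U = inv U" by (rule cadjoint_eqI)
    have "bounded_linear U"
      using add scale[of "of_real _"] norm True
      by (intro bounded_linear_intro[where K = 1]) (simp_all add: scaleR_eq_scaleC)
    then have "unitary_op U"
      using scale True \<open>inj U\<close> \<open>surj U\<close>
      by (simp add: unitary_op_def bounded_clinear_def adj surj_iff)
    with l \<phi> adj show ?thesis
      by (intro exI[of _ U] exI[of _ l]) simp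
  next
    case False
    then have "\<sigma> = cnj" using \<sigma> by (simp add: conj_or_id_def)
    then have "cinner (U x) y = cinner (inv U y) x" for x y
      using inner[of x "inv U y"] cinner_commute[of "inv U y" x] by (simp add: U_inv)
    then have "conj_adjoint U = inv U"
      by (intro conj_adjoint_eqI) (simp add: is_conj_adjoint_def)
    moreover have "antiunitary_op U"
      using add scale norm \<open>bij U\<close> \<open>\<sigma> = cnj\<close> by (simp add: antiunitary_op_def)
    ultimately show ?thesis
      using l \<phi> by (intro exI[of _ U] exI[of _ l]) simp
  qed
qed

end
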